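(* Assume (A1)–(A4) and that the critical value is $0$. Let $u\in C(\overline\Omega)$ be a viscosity subsolution of \[ H(x,Du)=0\ \text{in }\Omega,\qquad \gamma(x)\cdot Du=g(x)\ \text{on }\partial\Omega. \] Let $T>0$, $I=[0,T]$, and let $\eta:I\to\mathbb R^n$ be absolutely continuous with $\eta(t)\in\overline\Omega$ for all $t\in I$. Set $I_\partial=\{t\in I:\eta(t)\in\partial\Omega\}$. Then there exists $p\in L^\infty(I,\mathbb R^n)$ such that \[ \frac{d}{dt}u(\eta(t))=p(t)\cdot\dot\eta(t)\ \text{a.e. } t\in I,\qquad H(\eta(t),p(t))\le 0\ \text{a.e. } t\in I,\qquad \gamma(\eta(t))\cdot p(t)\le g(\eta(t))\ \text{a.e. } t\in I_\partial. \]
   Context: $\Omega\subset\mathbb R^n$ is a bounded domain; $H\in C(\overline\Omega\times\mathbb R^n)$, $g\in C(\partial\Omega)$, $\gamma\in C(\partial\Omega,\mathbb R^n)$. (A1) $p\mapsto H(x,p)$ is convex for each $x$; (A2) $H(x,p)\to\infty$ as $|p|\to\infty$ for all $x\in\overline\Omega$; (A3) $\Omega$ is a $C^1$ domain; (A4) $\nu(x)\cdot\gamma(x)>0$ on $\partial\Omega$, $\nu$ the outer unit normal. A viscosity subsolution here means: $H(x,p)\le0$ for all $p\in D^+u(x)$, $x\in\Omega$, and $\min\{H(x,p),\gamma(x)\cdot p-g(x)\}\le 0$ for all $p\in D^+_{\overline\Omega}u(x)$, $x\in\partial\Omega$, where $D^+_Vu(x)$ is the set of $p$ with $u(y)\le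 u(x)+p\cdot(y-x)+o(|y-x|)$ as $y\to x$, $y\in V$. "The critical value is $0$" means this boundary problem admits a viscosity solution. *)

theory Defs
  imports "HOL-Analysis.Analysis"
begin

definition abs_continuous_on :: "real set \<Rightarrow> (real \<Rightarrow> 'a::real_normed_vector) \<Rightarrow> bool" where
  "abs_continuous_on I f \<longleftrightarrow>
     (\<forall>\<epsilon>>0. \<exists>\<delta>>0. \<forall>(n::nat) (a::nat \<Rightarrow> real) (b::nat \<Rightarrow> real).
        (\<forall>k<n. a k \<le> b k \<and> {a k..b k} \<subseteq> I) \<and>
        (\<forall>i<n. \<forall>j<n. i \<noteq> j \<longrightarrow> b i \<le> a j \<or> b j \<le> a i) \<and>
        (\<Sum>k<n. b k - a k) < \<delta>
        \<longrightarrow> (\<Sum>k<n. norm (f (b k) - f (a k))) < \<epsilon>)"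

definition superdiff :: "'a::real_inner set \<Rightarrow> ('a \<Rightarrow> real) \<Rightarrow> 'a \<Rightarrow> 'a set" where
  "superdiff V u x = {p. \<forall>\<epsilon>>0. \<exists>\<delta>>0. \<forall>y\<in>V. norm (y - x) < \<delta> \<longrightarrow>
        u y \<le> u x + p \<bullet> (y - x) + \<epsilon> * norm (y - x)}"

definition subdiff :: "'a::real_inner set \<Rightarrow> ('a \<Rightarrow> real) \<Rightarrow> 'a \<Rightarrow> 'a set" where
  "subdiff V u x = {p. \<forall>\<epsilon>>0. \<exists>\<delta>>0. \<forall>y\<in>V. norm (y - x) < \<delta> \<longrightarrow>
        u y \<ge> u x + p \<bullet> (y - x) - \<epsilon> * norm (y - x)}"

text \<open>Viscosity subsolution of  H(x,Du)=0 in \<Omega>,  \<gamma>\<cdot>Du = g on \<partial>\<Omega>.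
  For interior points, D^+u(x) is computed relative to the closure of \<Omega>, which
  coincides with the usual one since \<Omega> is open.\<close>
definition visc_subsol ::
  "'a::euclidean_space set \<Rightarrow> ('a \<Rightarrow> 'a \<Rightarrow> real) \<Rightarrow> ('a \<Rightarrow> 'a) \<Rightarrow> ('a \<Rightarrow> real) \<Rightarrow> ('a \<Rightarrow> real) \<Rightarrow> bool" where
  "visc_subsol \<Omega> H \<gamma> g u \<longleftrightarrow>
     continuous_on (closure \<Omega>) u \<and>
     (\<forall>x\<in>\<Omega>. \<forall>p\<in>superdiff (closure \<Omega>) u x. H x p \<le> 0) \<and>
     (\<forall>x\<in>frontier \<Omega>. \<forall>p\<in>superdiff (closure \<Omega>) u x. min (H x p) (\<gamma> x \<bullet> p - g x) \<le> 0)"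

definition visc_supersol ::
  "'a::euclidean_space set \<Rightarrow> ('a \<Rightarrow> 'a \<Rightarrow> real) \<Rightarrow> ('a \<Rightarrow> 'a) \<Rightarrow> ('a \<Rightarrow> real) \<Rightarrow> ('a \<Rightarrow> real) \<Rightarrow> bool" where
  "visc_supersol \<Omega> H \<gamma> g u \<longleftrightarrow>
     continuous_on (closure \<Omega>) u \<and>
     (\<forall>x\<in>\<Omega>. \<forall>p\<in>subdiff (closure \<Omega>) u x. H x p \<ge> 0) \<and>
     (\<forall>x\<in>frontier \<Omega>. \<forall>p\<in>subdiff (closure \<Omega>) u x. max (H x p) (\<gamma> x \<bullet> p - g x) \<ge> 0)"

definition visc_sol ::
  "'a::euclidean_space set \<Rightarrow> ('a \<Rightarrow> 'a \<Rightarrow> real) \<Rightarrow> ('a \<Rightarrow> 'a) \<Rightarrow> ('a \<Rightarrow> real) \<Rightarrow> ('a \<Rightarrow> real) \<Rightarrow> bool" where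
  "visc_sol \<Omega> H \<gamma> g u \<longleftrightarrow> visc_subsol \<Omega> H \<gamma> g u \<and> visc_supersol \<Omega> H \<gamma> g u"

definition critical_value_zero ::
  "'a::euclidean_space set \<Rightarrow> ('a \<Rightarrow> 'a \<Rightarrow> real) \<Rightarrow> ('a \<Rightarrow> 'a) \<Rightarrow> ('a \<Rightarrow> real) \<Rightarrow> bool" where
  "critical_value_zero \<Omega> H \<gamma> g \<longleftrightarrow> (\<exists>v. visc_sol \<Omega> H \<gamma> g v)"

end

theory Submission
  imports Defs
begin

text \<open>
  Coercivity bounds the superdifferentials of \<open>u\<close> in \<open>\<Omega>\<close>, so \<open>u\<close> is Lipschitz on the closure and
  \<open>u \<circ> \<eta>\<close> is absolutely continuous; hence \<open>\<eta>\<close> and \<open>u \<circ> \<eta>\<close> are differentiable almost everywhere.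
  Fix a time \<open>t\<close> where both are, with derivatives \<open>v\<close> and \<open>q\<close>. If \<open>x = \<eta> t\<close> lies on the boundary,
  then \<open>\<rho> \<circ> \<eta>\<close> is maximal at \<open>t\<close>, so \<open>v\<close> is tangential. Touching \<open>u\<close> from above near \<open>x\<close> by functions
  whose slope is at least \<open>q - \<epsilon>\<close> along \<open>v\<close>, and at most \<open>g x + \<epsilon>\<close> along \<open>\<gamma> x\<close> with equality at boundary
  points, forces \<open>H \<le> 0\<close> at the contact points. The limit \<open>\<epsilon> \<longrightarrow> 0\<close> gives \<open>p1\<close> with \<open>H x p1 \<le> 0\<close>,
  \<open>\<gamma> x \<bullet> p1 \<le> g x\<close> and \<open>p1 \<bullet> v \<ge> q\<close>; reversing the curve gives \<open>p2\<close> with \<open>p2 \<bullet> v \<le> q\<close>, and a convex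
  combination attains \<open>q\<close>. The admissible \<open>p\<close> at time \<open>t\<close> form a closed convex set depending measurably
  on \<open>t\<close>, whose element of least norm is a measurable selection.
\<close>

section \<open>Differentiability of absolutely continuous functions\<close>

text \<open>\<open>u\<close> need not be differentiable at any point of the curve, and its
  superdifferential at \<open>\<eta> t\<close> may be empty, so no chain rule is at hand. The vector
  sought is a limit of superdifferential elements at contact points near \<open>\<eta> t\<close>,
  with compactness from the coercivity bound. Touching from above controls the slope along
  \<open>v\<close> from one side only, which is why two gradients and convexity are needed for
  equality. The main obstacle is the boundary condition: it is a minimum, hence says nothing about
  \<open>H\<close> where the oblique inequality holds. A slope slightly above \<open>g\<close> at
  boundary contacts removes that alternative. But the test function must also be penalised to
  localise the contact, and penalties change slopes. Hence they are one-sided: inward motion is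
  penalised beyond a small depth only, outward motion is already limited by the tangent plane, and
  along \<open>v\<close> only a half-space is used, whose face the maximiser avoids because the
  curve itself offers a larger value.\<close>

lemma sum_increments_division:
  fixes f :: "real \<Rightarrow> 'a::real_normed_vector"
  assumes "a \<le> b" "D division_of {a..b}"
  shows "(\<Sum>K\<in>D. f (Sup K) - f (Inf K)) = f b - f a"
proof -
  define p where "p = (\<lambda>K. (Inf K, K)) ` D"
  have "p tagged_division_of {a..b}"
  proof (rule tagged_division_ofI)
    show "finite p" using assms(2) p_def by blast
    fix x K assume "(x, K) \<in> p"
    then have K: "K \<in> D" "x = Inf K" by (auto simp: p_def)
    then obtain l r where lr: "K = {l..r}" "l \<le> r" "K \<subseteq> {a..b}"
      using division_ofD(2-4)[OF assms(2)] by (metis atLeastatMost_empty_iff2 box_real(2))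
    then show "x \<in> K" "K \<subseteq> {a..b}" "\<exists>a b. K = cbox a b" using K by auto
    fix x' K' assume "(x', K') \<in> p" "(x, K) \<noteq> (x', K')"
    then show "interior K \<inter> interior K' = {}"
      using K division_ofD(5)[OF assms(2)] by (auto simp: p_def)
  next
    show "\<Union> {K. \<exists>x. (x, K) \<in> p} = {a..b}"
    proof -
      have "{K. \<exists>x. (x, K) \<in> p} = D" by (auto simp: p_def)
      then show ?thesis using division_ofD(6)[OF assms(2)] by simp
    qed
  qed
  from additive_tagged_division_1[OF assms(1) this, of f]
  show ?thesis
    by (simp add: p_def sum.reindex inj_on_def)
qed

lemma division_interval_cases:
  fixes D :: "real set set"
  assumes "D division_of S" "K \<in> D"
  obtains l r where "K = {l..r}" "l \<le> r" "{l..r} \<subseteq> S"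
  using division_ofD(2-4)[OF assms] 
  by (metis assms atLeastatMost_empty_iff2 box_real(2) division_ofD(2-4))

text \<open>The signed increments over any division telescope to \<open>s * (f r - f l)\<close>.
  Bounding the absolute increment by minus the signed one on the intervals of \<open>p\<close> gains
  at least \<open>2 * c\<close> times their length. Zero-length cells are discarded so that
  divisions of different cells can share no member.\<close>

lemma refine_cell:
  fixes f :: "real \<Rightarrow> real"
  assumes lr: "l < r" and fin: "finite p"
    and p: "\<And>J. J \<in> p \<Longrightarrow> \<exists>x y. J = {x..y} \<and> x < y \<and> {x..y} \<subseteq> {l..r}
             \<and> s * (f y - f x) \<le> - c * (y - x)"
    and disj: "pairwise disjnt p"
    and s: "s = 1 \<or> s = -1"
  obtains R where "R division_of {l..r}" "p \<subseteq> R" "\<And>K. K \<in> R \<Longrightarrow> measure lborel K \<noteq> 0"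
    "(\<Sum>K\<in>R. \<bar>f (Sup K) - f (Inf K)\<bar>) \<ge> s * (f r - f l) + 2 * c * (\<Sum>J\<in>p. measure lborel J)"
proof -
  let ?d = "\<lambda>K. f (Sup K) - f (Inf K)"
  have "p division_of \<Union>p"
  proof (rule division_ofI)
    fix K1 K2 assume "K1 \<in> p" "K2 \<in> p" "K1 \<noteq> K2"
    then have "K1 \<inter> K2 = {}" using disj by (auto simp: pairwise_def disjnt_def)
    then show "interior K1 \<inter> interior K2 = {}" using interior_subset by blast
  qed (use fin p in \<open>force+\<close>)
  moreover have "\<Union>p \<subseteq> cbox l r" using p by fastforce
  ultimately obtain q where q: "p \<subseteq> q" "q division_of cbox l r"
    by (rule partial_division_extend_interval)
  define R where "R = {K \<in> q. measure lborel K \<noteq> 0}"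
  have R: "R division_of cbox l r"
    unfolding R_def using q lr by (intro division_of_nontrivial) auto
  have R': "R division_of {l..r}" using R by simp
  have pR: "p \<subseteq> R" using q p by (force simp: R_def)
  have finR: "finite R" using R by blast
  have sabs: "s * x \<le> \<bar>x\<bar>" "- (s * x) \<le> \<bar>x\<bar>" for x using s by auto
  have "(\<Sum>K\<in>R. \<bar>?d K\<bar>) = (\<Sum>K\<in>R - p. \<bar>?d K\<bar>) + (\<Sum>K\<in>p. \<bar>?d K\<bar>)"
    using sum.subset_diff[OF pR finR] by blast
  also have "\<dots> \<ge> (\<Sum>K\<in>R - p. s * ?d K) + (\<Sum>K\<in>p. - (s * ?d K))"
    by (intro add_mono sum_mono sabs)
  also have "(\<Sum>K\<in>R - p. s * ?d K) = s * (f r - f l) - (\<Sum>K\<in>p. s * ?d K)"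
    using sum.subset_diff[OF pR finR, of "\<lambda>K. s * ?d K"]
      sum_increments_division[OF _ R', of f] lr by (simp add: sum_distrib_left[symmetric])
  finally have "(\<Sum>K\<in>R. \<bar>?d K\<bar>) \<ge> s * (f r - f l) + 2 * (\<Sum>K\<in>p. - (s * ?d K))"
    by (simp add: sum_negf)
  moreover have "(\<Sum>K\<in>p. - (s * ?d K)) \<ge> (\<Sum>K\<in>p. c * measure lborel K)"
  proof (rule sum_mono)
    fix K assume "K \<in> p"
    from p[OF this] show "c * measure lborel K \<le> - (s * ?d K)" by auto
  qed
  ultimately have "(\<Sum>K\<in>R. \<bar>?d K\<bar>) \<ge> s * (f r - f l) + 2 * c * (\<Sum>J\<in>p. measure lborel J)"
    by (simp add: sum_distrib_left[symmetric])
  then show thesis using that R' pR by (auto simp: R_def)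
qed

text \<open>Converts a bound on finite disjoint families into one on outer measure: a countable
  disjoint subfamily covers \<open>E - Z\<close> up to a null set, and the measure of its union is
  controlled by finite subfamilies. \<open>Z\<close> exempts points, such as endpoints of a
  division, at which no fine cover is available.\<close>

lemma Vitali_small_measure:
  fixes E :: "real set"
  assumes pos: "\<And>l r. (l, r) \<in> C \<Longrightarrow> l < r"
    and fine: "\<And>t d. t \<in> E - Z \<Longrightarrow> d > 0 \<Longrightarrow> \<exists>(l, r)\<in>C. l \<le> t \<and> t \<le> r \<and> r - l < d"
    and Z: "negligible Z"
    and small: "\<And>F. finite F \<Longrightarrow> F \<subseteq> C \<Longrightarrow> pairwise disjnt ((\<lambda>(l, r). {l..r}) ` F)
       \<Longrightarrow> (\<Sum>J\<in>(\<lambda>(l, r). {l..r}) ` F. measure lborel J) \<le> e"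
  obtains U where "E \<subseteq> U" "U \<in> lmeasurable" "measure lebesgue U \<le> e"
proof -
  let ?I = "\<lambda>(l, r). {l..r::real}"
  \<comment> \<open>The covering theorem speaks of balls, so each interval is read as the closed
    ball about its midpoint.\<close>
  let ?a = "\<lambda>(l, r). (l + r) / 2 :: real"
  let ?r = "\<lambda>(l, r). (r - l) / 2 :: real"
  have cb: "cball (?a i) (?r i) = ?I i" for i
    by (cases i) (auto simp: cball_eq_atLeastAtMost field_simps)
  obtain B where B: "countable B" "B \<subseteq> C"
     "pairwise (\<lambda>i j. disjnt (cball (?a i) (?r i)) (cball (?a j) (?r j))) B"
     "negligible(E - Z - (\<Union>i \<in> B. cball (?a i) (?r i)))"
  proof (rule Vitali_covering_theorem_cballs[of C ?r "E - Z" ?a])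
    show "\<And>i. i \<in> C \<Longrightarrow> 0 < ?r i" using pos by auto
    fix x d assume "x \<in> E - Z" "(0::real) < d"
    with fine[of x "2 * d"] obtain l r where "(l, r) \<in> C" "l \<le> x" "x \<le> r" "r - l < 2 * d"
      by auto
    then show "\<exists>i. i \<in> C \<and> x \<in> cball (?a i) (?r i) \<and> ?r i < d"
      unfolding cb by (intro exI[of _ "(l, r)"]) auto
  qed
  have dj: "pairwise disjnt (?I ` F)" if "F \<subseteq> B" for F
    using pairwise_subset[OF B(3) that] unfolding cb pairwise_image
    by (auto simp: pairwise_def)
  have *: "measure lebesgue (\<Union>i\<in>F. ?I i) \<le> e" if F: "F \<subseteq> B" "finite F" for F
  proof -
    have "measure lebesgue (\<Union>(?I ` F)) \<le> (\<Sum>J\<in>?I ` F. measure lebesgue J)"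
      using F by (intro measure_Union_le) auto
    also have "\<dots> \<le> e" 
    proof -
      have "(\<Sum>J\<in>?I ` F. measure lebesgue J) = (\<Sum>J\<in>?I ` F. measure lborel J)"
        by (intro sum.cong) auto
      also have "\<dots> \<le> e"
        using F B(2) by (intro small dj) auto
      finally show ?thesis .
    qed
    finally show ?thesis .
  qed
  have m: "?I i \<in> lmeasurable" for i by (cases i) auto
  \<comment> \<open>The uncovered null remainder is added back so that \<open>U\<close> contains all
    of \<open>E\<close>.\<close>
  define U where "U = (E - (\<Union>i\<in>B. ?I i)) \<union> (\<Union>i\<in>B. ?I i)"
  have neg: "negligible (E - (\<Union>i\<in>B. ?I i))" 
    by (rule negligible_subset[OF negligible_Un[OF B(4)[unfolded cb] Z]]) auto
  have fm: "(\<Union>i\<in>B. ?I i) \<in> lmeasurable"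
    using B(1) m * by (rule fmeasurable_UN_bound)
  have "measure lebesgue (\<Union>i\<in>B. ?I i) \<le> e"
    using B(1) m * by (rule measure_UN_bound)
  moreover have "measure lebesgue U \<le> measure lebesgue (E - (\<Union>i\<in>B. ?I i)) + measure lebesgue (\<Union>i\<in>B. ?I i)"
    unfolding U_def using neg fm by (intro measure_Un_le) (auto simp: negligible_imp_sets)
  ultimately have "measure lebesgue U \<le> e" using neg by (simp add: negligible_imp_measure0)
  moreover have "U \<in> lmeasurable"
    unfolding U_def using neg fm by (intro fmeasurable.Un) (auto simp: negligible_imp_measurable)
  moreover have "E \<subseteq> U" by (auto simp: U_def)
  ultimately show thesis using that by blast
qed


text \<open>Austin's argument: start from a division of almost maximal variation. At a bad point there are
  arbitrarily short intervals whose slope has the sign opposite to that of the surrounding cell, and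
  inserting such an interval raises the variation by at least \<open>2 c\<close> times its length.\<close>

lemma oscillating_increments_negligible:
  fixes f :: "real \<Rightarrow> real"
  assumes ab: "a < b" and c: "c > 0"
    and bv: "\<And>D. D division_of {a..b} \<Longrightarrow> (\<Sum>K\<in>D. \<bar>f (Sup K) - f (Inf K)\<bar>) \<le> B"
  shows "negligible {t\<in>{a<..<b}.
      (\<forall>d>0. \<exists>l r. l < t \<and> t < r \<and> r - l < d \<and> f r - f l \<ge> c * (r - l)) \<and>
      (\<forall>d>0. \<exists>l r. l < t \<and> t < r \<and> r - l < d \<and> f r - f l \<le> - c * (r - l))}" (is "negligible ?E")
  unfolding negligible_outer_le
proof (intro allI impI)
  fix e :: real assume e: "e > 0"
  let ?d = "\<lambda>K. f (Sup K) - f (Inf K)"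
  define var where "var D = (\<Sum>K\<in>D. \<bar>?d K\<bar>)" for D
  define V where "V = (SUP D\<in>{D. D division_of {a..b}}. var D)"
  have bdd: "bdd_above (var ` {D. D division_of {a..b}})"
    using bv by (auto simp: var_def intro!: bdd_aboveI)
  have "\<exists>D. D division_of {a..b}" using elementary_interval[of a b] by auto
  \<comment> \<open>The slack \<open>2 * c * e\<close> is the variation gained by inserting
    intervals of total length \<open>e\<close>; a longer family of bad intervals would push the
    variation above the supremum \<open>V\<close>.\<close>
  then obtain D0 where D0: "D0 division_of {a..b}" "V - 2 * c * e < var D0"
    using less_cSUP_iff[OF _ bdd, of "V - 2 * c * e"] c e by (auto simp: V_def)
  define D where "D = {K \<in> D0. measure lborel K \<noteq> 0}"
  have D: "D division_of {a..b}"
    unfolding D_def using D0 ab division_of_nontrivial[of D0 a b] by auto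
  have finD: "finite D" using D by blast
  have "var D0 = var D"
    unfolding var_def
  proof (rule sum.mono_neutral_right)
    show "\<forall>i\<in>D0 - D. \<bar>?d i\<bar> = 0"
    proof
      fix K assume K: "K \<in> D0 - D"
      then obtain l r where "K = {l..r}" "l \<le> r" using D0(1) by (auto elim: division_interval_cases)
      then show "\<bar>?d K\<bar> = 0" using K by (auto simp: D_def)
    qed
  qed (use D0(1) in \<open>auto simp: D_def\<close>)
  with D0 have varD: "V - 2 * c * e < var D" by simp
  define s :: "real set \<Rightarrow> real" where "s K = (if ?d K \<ge> 0 then 1 else -1)" for K
  define C where "C = {(l, r). l < r \<and> (\<exists>K\<in>D. {l..r} \<subseteq> K \<and> s K * (f r - f l) \<le> - c * (r - l))}"
  \<comment> \<open>At an endpoint of a cell no straddling interval fits inside that cell; there are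
    finitely many such points.\<close>
  define Z where "Z = (\<Union>K\<in>D. {Inf K, Sup K})"
  obtain U where "?E \<subseteq> U" "U \<in> lmeasurable" "measure lebesgue U \<le> e"
  proof (rule Vitali_small_measure[of C ?E Z e])
    show "negligible Z" using finD by (auto simp: Z_def intro!: negligible_finite)
    show "\<And>l r. (l, r) \<in> C \<Longrightarrow> l < r" by (auto simp: C_def)
  next
    fix t d :: real assume t: "t \<in> ?E - Z" and d: "d > 0"
    then have "t \<in> {a..b}" by auto
    then obtain K where K: "K \<in> D" "t \<in> K" using D by blast
    then obtain x y where xy: "K = {x..y}" "x \<le> y" using D by (metis division_interval_cases)
    have "x < t" "t < y" using t K xy by (force simp: Z_def)+
    define d' where "d' = min d (min (t - x) (y - t))"
    have d': "d' > 0" using \<open>x < t\<close> \<open>t < y\<close> d by (auto simp: d'_def)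
    have "\<exists>l r. l < t \<and> t < r \<and> r - l < d' \<and> s K * (f r - f l) \<le> - c * (r - l)"
    proof (cases "?d K \<ge> 0")
      case True
      moreover have "\<exists>l r. l < t \<and> t < r \<and> r - l < d' \<and> f r - f l \<le> - c * (r - l)"
        using t d' by blast
      ultimately show ?thesis by (simp add: s_def)
    next
      case False
      moreover obtain l r where "l < t \<and> t < r \<and> r - l < d' \<and> f r - f l \<ge> c * (r - l)"
        using t d' by blast
      ultimately show ?thesis by (intro exI[of _ l] exI[of _ r]) (auto simp: s_def)
    qed
    then obtain l r where lr: "l < t" "t < r" "r - l < d'" "s K * (f r - f l) \<le> - c * (r - l)"
      by blast
    then have "{l..r} \<subseteq> K" using xy by (auto simp: d'_def)
    then have "(l, r) \<in> C" using lr K by (auto simp: C_def)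
    then show "\<exists>(l, r)\<in>C. l \<le> t \<and> t \<le> r \<and> r - l < d"
      using lr by (intro bexI[of _ "(l, r)"]) (auto simp: d'_def)
  next
    fix F assume F: "finite F" "F \<subseteq> C" "pairwise disjnt ((\<lambda>(l, r). {l..r}) ` F)"
    define p where "p = (\<lambda>(l, r). {l..r}) ` F"
    define q where "q K = {J\<in>p. J \<subseteq> K \<and> s K * ?d J \<le> - c * (Sup J - Inf J)}" for K
    have finp: "finite p" using F by (simp add: p_def)
    have pI: "\<exists>x y. J = {x..y} \<and> x < y \<and> (\<exists>K\<in>D. J \<in> q K)" if "J \<in> p" for J
    proof -
      from that obtain l r where lr: "(l, r) \<in> F" "J = {l..r}" by (auto simp: p_def)
      then have "(l, r) \<in> C" using F by auto
      then show ?thesis using lr that by (force simp: C_def q_def)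
    qed
    have "\<exists>R. R division_of K \<and> q K \<subseteq> R \<and> (\<forall>J\<in>R. measure lborel J \<noteq> 0) \<and>
        var R \<ge> \<bar>?d K\<bar> + 2 * c * (\<Sum>J\<in>q K. measure lborel J)" if KD: "K \<in> D" for K
    proof -
      obtain l r where lr: "K = {l..r}" "l \<le> r"
        by (rule division_interval_cases[OF D KD])
      have "measure lborel K \<noteq> 0" using KD by (simp add: D_def)
      then have "l < r" using lr by (cases "l = r") auto
      obtain R where R: "R division_of {l..r}" "q K \<subseteq> R" "\<And>K. K \<in> R \<Longrightarrow> measure lborel K \<noteq> 0"
        "(\<Sum>K\<in>R. \<bar>f (Sup K) - f (Inf K)\<bar>) \<ge> s K * (f r - f l) + 2 * c * (\<Sum>J\<in>q K. measure lborel J)"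
      proof (rule refine_cell[OF \<open>l < r\<close>, of "q K" "s K" f c])
        show "finite (q K)" using finp by (simp add: q_def)
        show "pairwise disjnt (q K)" using F(3) by (auto simp: q_def p_def intro: pairwise_subset)
        show "s K = 1 \<or> s K = -1" by (simp add: s_def)
        fix J assume J: "J \<in> q K"
        then have "J \<in> p" by (simp add: q_def)
        from pI[OF this] obtain x y where "J = {x..y}" "x < y" by blast
        then show "\<exists>x y. J = {x..y} \<and> x < y \<and> {x..y} \<subseteq> {l..r} \<and> s K * (f y - f x) \<le> - c * (y - x)"
          using J lr by (intro exI[of _ x] exI[of _ y]) (auto simp: q_def)
      qed auto
      moreover have "s K * (f r - f l) = \<bar>?d K\<bar>" using lr by (simp add: s_def)
      ultimately show ?thesis unfolding var_def lr(1)[symmetric] by metis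
    qed
    then obtain R where R: "\<And>K. K \<in> D \<Longrightarrow> R K division_of K" "\<And>K. K \<in> D \<Longrightarrow> q K \<subseteq> R K"
      "\<And>K J. K \<in> D \<Longrightarrow> J \<in> R K \<Longrightarrow> measure lborel J \<noteq> 0"
      "\<And>K. K \<in> D \<Longrightarrow> var (R K) \<ge> \<bar>?d K\<bar> + 2 * c * (\<Sum>J\<in>q K. measure lborel J)"
      by metis
    have sep: "interior J1 \<inter> interior J2 = {}"
      if "K1 \<in> D" "K2 \<in> D" "J1 \<in> R K1" "J2 \<in> R K2" "K1 \<noteq> K2" for J1 J2 K1 K2
    proof -
      have "J1 \<subseteq> K1" "J2 \<subseteq> K2" using R(1) that by blast+
      moreover have "interior K1 \<inter> interior K2 = {}" using D that by blast
      ultimately show ?thesis using interior_mono by blast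
    qed
    \<comment> \<open>A common member would have empty interior, yet every member has positive
      length. Disjointness makes the variation of the union the sum of the variations.\<close>
    have disjR: "R K1 \<inter> R K2 = {}" if K1: "K1 \<in> D" and "K2 \<in> D" "K1 \<noteq> K2" for K1 K2
    proof (rule ccontr)
      assume "R K1 \<inter> R K2 \<noteq> {}"
      then obtain J where J: "J \<in> R K1" "J \<in> R K2" by blast
      then have "interior J = {}" using sep that by blast
      moreover obtain x y where "J = {x..y}" "x \<le> y"
        by (rule division_interval_cases[OF R(1)[OF K1] J(1)])
      ultimately show False using R(3)[OF K1 J(1)] by auto
    qed
    have finR: "finite (R K)" if "K \<in> D" for K using R(1)[OF that] by blast
    have "(\<Union>K\<in>D. R K) division_of {a..b}"
    proof (rule division_ofI)
      show "finite (\<Union>K\<in>D. R K)" using finD finR by auto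
      fix J assume "J \<in> (\<Union>K\<in>D. R K)"
      then obtain K where K: "K \<in> D" "J \<in> R K" by blast
      then show "J \<noteq> {}" "\<exists>a b. J = cbox a b" using R(1) by blast+
      have "J \<subseteq> K" "K \<subseteq> {a..b}" using K R(1) D by blast+
      then show "J \<subseteq> {a..b}" by blast
      fix J' assume "J' \<in> (\<Union>K\<in>D. R K)" "J \<noteq> J'"
      then obtain K' where K': "K' \<in> D" "J' \<in> R K'" "J \<noteq> J'" by blast
      show "interior J \<inter> interior J' = {}"
      proof (cases "K = K'")
        case True
        then show ?thesis using K K' R(1)[of K] by (meson division_ofD(5))
      next
        case False
        then show ?thesis using sep K K' by blast
      qed
    next
      have "\<Union>(\<Union>K\<in>D. R K) = (\<Union>K\<in>D. \<Union>(R K))" by blast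
      also have "\<dots> = (\<Union>K\<in>D. K)"
        by (intro SUP_cong refl) (use R(1) in \<open>blast dest: division_ofD(6)\<close>)
      also have "\<dots> = {a..b}" using division_ofD(6)[OF D] by simp
      finally show "\<Union>(\<Union>K\<in>D. R K) = {a..b}" .
    qed
    then have "var (\<Union>K\<in>D. R K) \<le> V"
      unfolding V_def by (intro cSUP_upper bdd) auto
    also have "var (\<Union>K\<in>D. R K) = (\<Sum>K\<in>D. var (R K))"
      unfolding var_def using finD finR disjR by (intro sum.UNION_disjoint) auto
    also have "(\<Sum>K\<in>D. var (R K)) \<ge> (\<Sum>K\<in>D. \<bar>?d K\<bar> + 2 * c * (\<Sum>J\<in>q K. measure lborel J))"
      by (rule sum_mono) (rule R(4))
    finally have "V \<ge> (\<Sum>K\<in>D. \<bar>?d K\<bar> + 2 * c * (\<Sum>J\<in>q K. measure lborel J))" .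
    then have "V \<ge> var D + 2 * c * (\<Sum>K\<in>D. \<Sum>J\<in>q K. measure lborel J)"
      by (simp add: sum.distrib var_def sum_distrib_left)
    then have "2 * c * (\<Sum>K\<in>D. \<Sum>J\<in>q K. measure lborel J) \<le> 2 * c * e" using varD by linarith
    then have "(\<Sum>K\<in>D. \<Sum>J\<in>q K. measure lborel J) \<le> e" using c by simp
    moreover have "(\<Sum>J\<in>p. measure lborel J) \<le> (\<Sum>K\<in>D. \<Sum>J\<in>q K. measure lborel J)"
    proof -
      have "(\<Sum>J\<in>p. measure lborel J) \<le> (\<Sum>J\<in>(\<Union>K\<in>D. q K). measure lborel J)"
        using finp finD pI by (intro sum_mono2) (auto simp: q_def)
      also have "\<dots> = (\<Sum>K\<in>D. \<Sum>J\<in>q K. measure lborel J)"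
      proof (rule sum.UNION_disjoint)
        show "\<forall>K1\<in>D. \<forall>K2\<in>D. K1 \<noteq> K2 \<longrightarrow> q K1 \<inter> q K2 = {}" using disjR R(2) by blast
      qed (use finD finp in \<open>auto simp: q_def\<close>)
      finally show ?thesis .
    qed
    ultimately show "(\<Sum>J\<in>(\<lambda>(l, r). {l..r}) ` F. measure lborel J) \<le> e" by (simp add: p_def)
  qed
  then show "\<exists>U. ?E \<subseteq> U \<and> U \<in> lmeasurable \<and> measure lebesgue U \<le> e" by blast
qed

text \<open>Disjoint intervals whose slope is at least \<open>c\<close> in absolute value have total
  length at most \<open>B / c\<close>, and on this set \<open>c\<close> is arbitrary.\<close>

lemma infinite_slope_negligible:
  fixes f :: "real \<Rightarrow> real"
  assumes ab: "a < b"
    and bv: "\<And>D. D division_of {a..b} \<Longrightarrow> (\<Sum>K\<in>D. \<bar>f (Sup K) - f (Inf K)\<bar>) \<le> B"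
  shows "negligible {t\<in>{a<..<b}.
      \<forall>c. \<forall>d>0. \<exists>l r. l < t \<and> t < r \<and> r - l < d \<and> \<bar>f r - f l\<bar> \<ge> c * (r - l)}" (is "negligible ?E")
  unfolding negligible_outer_le
proof (intro allI impI)
  fix e :: real assume e: "e > 0"
  let ?d = "\<lambda>K. f (Sup K) - f (Inf K)"
  \<comment> \<open>\<open>B\<close> comes with no explicit sign, hence \<open>max 0 B\<close>; the
    summand \<open>1\<close> keeps \<open>c\<close> positive.\<close>
  define c where "c = max 0 B / e + 1"
  have "c * e = max 0 B + e" using e by (simp add: c_def field_simps)
  then have c: "c > 0" "B \<le> c * e" using e by (auto simp: c_def add_nonneg_pos)
  define C where "C = {(l, r). l < r \<and> {l..r} \<subseteq> {a..b} \<and> \<bar>f r - f l\<bar> \<ge> c * (r - l)}"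
  obtain U where "?E \<subseteq> U" "U \<in> lmeasurable" "measure lebesgue U \<le> e"
  proof (rule Vitali_small_measure[of C ?E "{}" e])
    show "negligible {}" by simp
    show "\<And>l r. (l, r) \<in> C \<Longrightarrow> l < r" by (auto simp: C_def)
  next
    fix t d :: real assume t: "t \<in> ?E - {}" and d: "d > 0"
    define d' where "d' = min d (min (t - a) (b - t))"
    have d': "d' > 0" using t d by (auto simp: d'_def)
    then obtain l r where lr: "l < t" "t < r" "r - l < d'" "\<bar>f r - f l\<bar> \<ge> c * (r - l)"
      using t by blast
    then have "(l, r) \<in> C" by (auto simp: C_def d'_def)
    then show "\<exists>(l, r)\<in>C. l \<le> t \<and> t \<le> r \<and> r - l < d"
      using lr by (intro bexI[of _ "(l, r)"]) (auto simp: d'_def)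
  next
    fix F assume F: "finite F" "F \<subseteq> C" "pairwise disjnt ((\<lambda>(l, r). {l..r}) ` F)"
    define p where "p = (\<lambda>(l, r). {l..r}) ` F"
    have finp: "finite p" using F by (simp add: p_def)
    have pI: "\<exists>x y. J = {x..y} \<and> x < y \<and> J \<subseteq> {a..b} \<and> \<bar>f y - f x\<bar> \<ge> c * (y - x)" if "J \<in> p" for J
    proof -
      from that obtain l r where lr: "(l, r) \<in> F" "J = {l..r}" by (auto simp: p_def)
      then have "(l, r) \<in> C" using F by auto
      then show ?thesis using lr by (force simp: C_def)
    qed
    have "p division_of \<Union>p"
    proof (rule division_ofI)
      fix K1 K2 assume "K1 \<in> p" "K2 \<in> p" "K1 \<noteq> K2"
      then have "K1 \<inter> K2 = {}"
        using F(3) unfolding p_def[symmetric] by (auto simp: pairwise_def disjnt_def)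
      then show "interior K1 \<inter> interior K2 = {}" using interior_subset by blast
    qed (use finp pI in \<open>force+\<close>)
    moreover have "\<Union>p \<subseteq> cbox a b" using pI by fastforce
    ultimately obtain q where q: "p \<subseteq> q" "q division_of cbox a b"
      by (rule partial_division_extend_interval)
    have "c * (\<Sum>J\<in>p. measure lborel J) \<le> (\<Sum>J\<in>p. \<bar>?d J\<bar>)"
      unfolding sum_distrib_left
    proof (rule sum_mono)
      fix J assume "J \<in> p"
      from pI[OF this] show "c * measure lborel J \<le> \<bar>?d J\<bar>" by auto
    qed
    also have "\<dots> \<le> (\<Sum>J\<in>q. \<bar>?d J\<bar>)"
      using q by (intro sum_mono2) auto
    also have "\<dots> \<le> B" using bv q by simp
    also have "\<dots> \<le> c * e" by fact
    finally show "(\<Sum>J\<in>(\<lambda>(l, r). {l..r}) ` F. measure lborel J) \<le> e" using c by (simp add: p_def)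
  qed
  then show "\<exists>U. ?E \<subseteq> U \<and> U \<in> lmeasurable \<and> measure lebesgue U \<le> e" by blast
qed


text \<open>The exceptional sets above involve only intervals with \<open>t\<close> in their
  interior. Letting one endpoint tend to \<open>t\<close>, continuity transfers the bound to
  ordinary difference quotients.\<close>

lemma has_real_derivative_at_straddle:
  fixes f :: "real \<Rightarrow> real"
  assumes cont: "isCont f t"
    and str: "\<And>e. e > 0 \<Longrightarrow> \<exists>d>0. \<forall>l r. l < t \<and> t < r \<and> r - l < d \<longrightarrow>
                \<bar>f r - f l - D * (r - l)\<bar> \<le> e * (r - l)"
  shows "(f has_real_derivative D) (at t)"
  unfolding has_field_derivative_def has_derivative_at_alt
proof (intro conjI allI impI)
  show "bounded_linear ((*) D)" by (rule bounded_linear_mult_right)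
  fix e :: real assume "e > 0"
  from str[OF this] obtain d where d: "d > 0"
    "\<And>l r. l < t \<Longrightarrow> t < r \<Longrightarrow> r - l < d \<Longrightarrow> \<bar>f r - f l - D * (r - l)\<bar> \<le> e * (r - l)" by blast
  have lim: "(f \<longlongrightarrow> f t) (at_left t)" "(f \<longlongrightarrow> f t) (at_right t)"
    using cont by (simp_all add: isCont_def filterlim_at_split)
  have "\<bar>f y - f t - D * (y - t)\<bar> \<le> e * \<bar>y - t\<bar>" if y: "\<bar>y - t\<bar> < d" for y
  proof -
    consider "y = t" | "t < y" | "y < t" by linarith
    then show ?thesis
    proof cases
      case 2
      have "\<bar>f y - f t - D * (y - t)\<bar> - e * (y - t) \<le> 0"
      proof (rule tendsto_upperbound)
        show "((\<lambda>l. \<bar>f y - f l - D * (y - l)\<bar> - e * (y - l)) \<longlongrightarrow> \<bar>f y - f t - D * (y - t)\<bar> - e * (y - t)) (at_left t)"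
          by (intro tendsto_intros lim)
        show "\<forall>\<^sub>F l in at_left t. \<bar>f y - f l - D * (y - l)\<bar> - e * (y - l) \<le> 0"
          unfolding eventually_at_left_field
          using d(2)[of _ y] 2 y by (intro exI[of _ "y - d"]) auto
      qed simp
      then show ?thesis using 2 by simp
    next
      case 3
      have "\<bar>f t - f y - D * (t - y)\<bar> - e * (t - y) \<le> 0"
      proof (rule tendsto_upperbound)
        show "((\<lambda>r. \<bar>f r - f y - D * (r - y)\<bar> - e * (r - y)) \<longlongrightarrow> \<bar>f t - f y - D * (t - y)\<bar> - e * (t - y)) (at_right t)"
          by (intro tendsto_intros lim)
        show "\<forall>\<^sub>F r in at_right t. \<bar>f r - f y - D * (r - y)\<bar> - e * (r - y) \<le> 0"
          unfolding eventually_at_right_field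
          using d(2)[of y] 3 y by (intro exI[of _ "y + d"]) auto
      qed simp
      then show ?thesis using 3 by (simp add: algebra_simps abs_minus_commute)
    qed simp
  qed
  then show "\<exists>d>0. \<forall>y. norm (y - t) < d \<longrightarrow> norm (f y - f t - D * (y - t)) \<le> e * norm (y - t)"
    using d(1) by auto
qed

text \<open>Subtracting \<open>q * x\<close> turns a gap between lower and upper slopes at
  \<open>t\<close> into increments oscillating about zero. Rational \<open>q\<close> and
  \<open>c\<close> detect every gap, so only countably many null sets are involved.\<close>

lemma bounded_variation_differentiable_ae:
  fixes f :: "real \<Rightarrow> real"
  assumes ab: "a < b" and cont: "continuous_on {a..b} f"
    and bv: "\<And>D. D division_of {a..b} \<Longrightarrow> (\<Sum>K\<in>D. \<bar>f (Sup K) - f (Inf K)\<bar>) \<le> B"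
  shows "negligible {t\<in>{a<..<b}. \<nexists>D. (f has_real_derivative D) (at t)}"
proof -
  define N0 where "N0 = {t\<in>{a<..<b}.
      \<forall>c. \<forall>d>0. \<exists>l r. l < t \<and> t < r \<and> r - l < d \<and> \<bar>f r - f l\<bar> \<ge> c * (r - l)}"
  define N where "N q c = {t\<in>{a<..<b}.
      (\<forall>d>0. \<exists>l r. l < t \<and> t < r \<and> r - l < d \<and> (f r - q * r) - (f l - q * l) \<ge> c * (r - l)) \<and>
      (\<forall>d>0. \<exists>l r. l < t \<and> t < r \<and> r - l < d \<and> (f r - q * r) - (f l - q * l) \<le> - c * (r - l))}" for q c
  have "negligible N0" unfolding N0_def by (rule infinite_slope_negligible[OF ab bv])
  moreover have "negligible (N q c)" if "c > 0" for q c
    unfolding N_def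
  proof (rule oscillating_increments_negligible[OF ab that])
    fix D assume D: "D division_of {a..b}"
    have "(\<Sum>K\<in>D. \<bar>f (Sup K) - q * Sup K - (f (Inf K) - q * Inf K)\<bar>)
        \<le> (\<Sum>K\<in>D. \<bar>f (Sup K) - f (Inf K)\<bar> + \<bar>q\<bar> * (Sup K - Inf K))"
    proof (rule sum_mono)
      fix K assume "K \<in> D"
      then obtain l r where "K = {l..r}" "l \<le> r" using D by (metis division_interval_cases)
      then have "\<bar>q * (Sup K - Inf K)\<bar> = \<bar>q\<bar> * (Sup K - Inf K)" by (simp add: abs_mult)
      then show "\<bar>f (Sup K) - q * Sup K - (f (Inf K) - q * Inf K)\<bar>
        \<le> \<bar>f (Sup K) - f (Inf K)\<bar> + \<bar>q\<bar> * (Sup K - Inf K)"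
        by (simp add: algebra_simps)
    qed
    also have "\<dots> = (\<Sum>K\<in>D. \<bar>f (Sup K) - f (Inf K)\<bar>) + \<bar>q\<bar> * (b - a)"
      using sum_increments_division[OF _ D, of "\<lambda>x. x"] ab
      by (simp add: sum.distrib sum_distrib_left[symmetric])
    also have "\<dots> \<le> B + \<bar>q\<bar> * (b - a)" using bv[OF D] by simp
    finally show "(\<Sum>K\<in>D. \<bar>f (Sup K) - q * Sup K - (f (Inf K) - q * Inf K)\<bar>) \<le> B + \<bar>q\<bar> * (b - a)" .
  qed
  ultimately have "negligible (N0 \<union> (\<Union>(q, c)\<in>\<rat> \<times> (\<rat> \<inter> {0<..}). N q c))"
    by (intro negligible_Un negligible_countable_Union) (auto simp: countable_rat)
  then show ?thesis
  proof (rule negligible_subset, intro subsetI)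
    fix t assume "t \<in> {t\<in>{a<..<b}. \<nexists>D. (f has_real_derivative D) (at t)}"
    then have tab: "t \<in> {a<..<b}" and nd: "\<nexists>D. (f has_real_derivative D) (at t)" by auto
    show "t \<in> N0 \<union> (\<Union>(q, c)\<in>\<rat> \<times> (\<rat> \<inter> {0<..}). N q c)"
    proof (rule ccontr)
      assume "\<not> ?thesis"
      then have n0: "t \<notin> N0" and n1: "\<And>q c. q \<in> \<rat> \<Longrightarrow> c \<in> \<rat> \<Longrightarrow> c > 0 \<Longrightarrow> t \<notin> N q c" by auto
      obtain M d0 where M: "d0 > 0" "\<And>l r. l < t \<Longrightarrow> t < r \<Longrightarrow> r - l < d0 \<Longrightarrow> \<bar>f r - f l\<bar> < M * (r - l)"
        using n0 tab unfolding N0_def by (auto simp: not_le)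
      \<comment> \<open>The slopes that eventually bound the straddling quotients from below. Its
        supremum is the lower derivative, finite because \<open>t \<notin> N0\<close> bounds the
        quotients by \<open>M\<close>.\<close>
      define A where "A = {x. \<exists>d>0. \<forall>l r. l < t \<and> t < r \<and> r - l < d \<longrightarrow> x * (r - l) \<le> f r - f l}"
      have "- M \<in> A" unfolding A_def using M by (force intro!: exI[of _ d0])
      have "x \<le> M" if "x \<in> A" for x
      proof -
        from that obtain d where d: "d > 0" "\<And>l r. l < t \<Longrightarrow> t < r \<Longrightarrow> r - l < d \<Longrightarrow> x * (r - l) \<le> f r - f l"
          unfolding A_def by blast
        define h where "h = min d d0 / 4"
        have h: "h > 0" "2 * h < d" "2 * h < d0" using d(1) M(1) by (auto simp: h_def)
        have "x * (2 * h) \<le> f (t + h) - f (t - h)" "\<bar>f (t + h) - f (t - h)\<bar> < M * (2 * h)"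
          using d(2)[of "t - h" "t + h"] M(2)[of "t - h" "t + h"] h by auto
        then have "x * (2 * h) \<le> M * (2 * h)" by linarith
        then show ?thesis using h by simp
      qed
      then have bA: "bdd_above A" by (rule bdd_aboveI)
      define D where "D = Sup A"
      have "(f has_real_derivative D) (at t)"
      proof (rule has_real_derivative_at_straddle)
        show "isCont f t"
          using cont tab continuous_on_interior[of "{a..b}" f t] by auto
        fix e :: real assume e: "e > 0"
        have "\<exists>x\<in>A. D - e < x"
          using less_cSup_iff[of A "D - e"] bA \<open>- M \<in> A\<close> e by (auto simp: D_def)
        then obtain d1 x where d1: "d1 > 0" "D - e < x"
          "\<And>l r. l < t \<Longrightarrow> t < r \<Longrightarrow> r - l < d1 \<Longrightarrow> x * (r - l) \<le> f r - f l"
          unfolding A_def by blast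
        \<comment> \<open>Thirds of \<open>e\<close> make \<open>q - c\<close> exceed
          \<open>D\<close>, so it is no eventual lower slope, while \<open>q + c\<close> stays below
          \<open>D + e\<close>. Avoiding \<open>N q c\<close> then forces the quotients eventually
          below \<open>q + c\<close>.\<close>
        obtain q where q: "q \<in> \<rat>" "D + e / 3 < q" "q < D + 2 * e / 3"
          using Rats_dense_in_real[of "D + e / 3" "D + 2 * e / 3"] e by auto
        obtain c where c: "c \<in> \<rat>" "0 < c" "c < e / 3"
          using Rats_dense_in_real[of 0 "e / 3"] e by auto
        have "\<not> (\<exists>d>0. \<forall>l r. l < t \<and> t < r \<and> r - l < d \<longrightarrow> - c * (r - l) < (f r - q * r) - (f l - q * l))"
        proof
          assume "\<exists>d>0. \<forall>l r. l < t \<and> t < r \<and> r - l < d \<longrightarrow> - c * (r - l) < (f r - q * r) - (f l - q * l)"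
          then have "q - c \<in> A" unfolding A_def by (force simp: algebra_simps)
          then have "q - c \<le> D" unfolding D_def by (intro cSup_upper bA)
          then show False using q c by linarith
        qed
        with n1[OF q(1) c(1,2)] tab obtain d2 where d2: "d2 > 0"
          "\<And>l r. l < t \<Longrightarrow> t < r \<Longrightarrow> r - l < d2 \<Longrightarrow> (f r - q * r) - (f l - q * l) < c * (r - l)"
          unfolding N_def by (simp add: not_le) (metis minus_mult_left)
        show "\<exists>d>0. \<forall>l r. l < t \<and> t < r \<and> r - l < d \<longrightarrow> \<bar>f r - f l - D * (r - l)\<bar> \<le> e * (r - l)"
        proof (intro exI[of _ "min d1 d2"] conjI allI impI)
          show "min d1 d2 > 0" using d1 d2 by simp
          fix l r assume lr: "l < t \<and> t < r \<and> r - l < min d1 d2"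
          have "(D - e) * (r - l) \<le> x * (r - l)" "(q + c) * (r - l) \<le> (D + e) * (r - l)"
            using lr d1(2) q c by (intro mult_right_mono; auto)+
          with d1(3)[of l r] d2(2)[of l r] lr
          show "\<bar>f r - f l - D * (r - l)\<bar> \<le> e * (r - l)" by (auto simp: algebra_simps abs_le_iff)
        qed
      qed
      with nd show False by blast
    qed
  qed
qed

section \<open>Absolutely continuous functions\<close>

lemma abs_continuous_on_imp_continuous_on:
  assumes "abs_continuous_on {a..b} f"
  shows "continuous_on {a..b} f"
  unfolding continuous_on_iff
proof (intro ballI allI impI)
  fix x e :: real assume x: "x \<in> {a..b}" and e: "e > 0"
  obtain d where d: "d > 0" and ac: "\<And>(n::nat) (l::nat \<Rightarrow> real) (r::nat \<Rightarrow> real).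
        (\<forall>k<n. l k \<le> r k \<and> {l k..r k} \<subseteq> {a..b}) \<Longrightarrow>
        (\<forall>i<n. \<forall>j<n. i \<noteq> j \<longrightarrow> r i \<le> l j \<or> r j \<le> l i) \<Longrightarrow>
        (\<Sum>k<n. r k - l k) < d \<Longrightarrow> (\<Sum>k<n. norm (f (r k) - f (l k))) < e"
    using assms[unfolded abs_continuous_on_def, rule_format, OF e] by blast
  show "\<exists>d>0. \<forall>x'\<in>{a..b}. dist x' x < d \<longrightarrow> dist (f x') (f x) < e"
  proof (intro exI[of _ d] conjI ballI impI d)
    fix y assume y: "y \<in> {a..b}" "dist y x < d"
    have "norm (f (max x y) - f (min x y)) < e"
      using ac[of 1 "\<lambda>_. min x y" "\<lambda>_. max x y"] x y by (auto simp: dist_real_def max_def min_def split: if_splits)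
    then show "dist (f y) (f x) < e"
      by (auto simp: dist_norm max_def min_def norm_minus_commute split: if_splits)
  qed
qed

lemma abs_continuous_on_division:
  assumes ac: "abs_continuous_on {a..b} f" and e: "e > 0"
  obtains d where "d > 0"
    "\<And>l r D. {l..r} \<subseteq> {a..b} \<Longrightarrow> l \<le> r \<Longrightarrow> r - l < d \<Longrightarrow> D division_of {l..r} \<Longrightarrow>
       (\<Sum>K\<in>D. norm (f (Sup K) - f (Inf K))) < e"
proof -
  obtain d where d: "d > 0" and ac: "\<And>(n::nat) (l::nat \<Rightarrow> real) (r::nat \<Rightarrow> real).
        (\<forall>k<n. l k \<le> r k \<and> {l k..r k} \<subseteq> {a..b}) \<Longrightarrow>
        (\<forall>i<n. \<forall>j<n. i \<noteq> j \<longrightarrow> r i \<le> l j \<or> r j \<le> l i) \<Longrightarrow>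
        (\<Sum>k<n. r k - l k) < d \<Longrightarrow> (\<Sum>k<n. norm (f (r k) - f (l k))) < e"
    using ac[unfolded abs_continuous_on_def, rule_format, OF e] by blast
  show thesis
  proof (rule that[OF d])
    fix l r D assume lr: "{l..r} \<subseteq> {a..b}" "l \<le> r" "r - l < d" and D: "D division_of {l..r}"
    \<comment> \<open>A one-point cell may lie inside another cell of a division, which violates the
      ordering condition in the definition of absolute continuity; its increment is zero, so it is
      dropped.\<close>
    define D' where "D' = {K\<in>D. Inf K < Sup K}"
    have finD: "finite D" using D by blast
    have D'D: "D' \<subseteq> D" by (auto simp: D'_def)
    have finD': "finite D'" using finD by (simp add: D'_def)
    have ival: "K = {Inf K..Sup K} \<and> Inf K \<le> Sup K \<and> K \<subseteq> {l..r}" if "K \<in> D" for K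
      using division_interval_cases[OF D that] by (metis cInf_atLeastAtMost cSup_atLeastAtMost)
    obtain h where h: "bij_betw h {..<card D'} D'"
      using ex_bij_betw_nat_finite[OF finD'] by (auto simp: atLeast0LessThan)
    have hD: "h k \<in> D'" if "k < card D'" for k using h that by (auto simp: bij_betw_def)
    have "(\<Sum>K\<in>D. norm (f (Sup K) - f (Inf K))) = (\<Sum>K\<in>D'. norm (f (Sup K) - f (Inf K)))"
    proof (rule sum.mono_neutral_right[OF finD D'D], intro ballI)
      fix K assume "K \<in> D - D'"
      then have "Sup K = Inf K" using ival[of K] by (force simp: D'_def)
      then show "norm (f (Sup K) - f (Inf K)) = 0" by simp
    qed
    also have "\<dots> = (\<Sum>k<card D'. norm (f (Sup (h k)) - f (Inf (h k))))"
      by (rule sum.reindex_bij_betw[OF h, symmetric])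
    also have "\<dots> < e"
    proof (rule ac)
      show "\<forall>k<card D'. Inf (h k) \<le> Sup (h k) \<and> {Inf (h k)..Sup (h k)} \<subseteq> {a..b}"
      proof (intro allI impI)
        fix k assume "k < card D'"
        then have "h k \<in> D" using hD D'D by blast
        from ival[OF this] lr(1) show "Inf (h k) \<le> Sup (h k) \<and> {Inf (h k)..Sup (h k)} \<subseteq> {a..b}"
          by (metis order_trans)
      qed
      show "\<forall>i<card D'. \<forall>j<card D'. i \<noteq> j \<longrightarrow> Sup (h i) \<le> Inf (h j) \<or> Sup (h j) \<le> Inf (h i)"
      proof (intro allI impI)
        fix i j assume ij: "i < card D'" "j < card D'" "i \<noteq> j"
        then have hij: "h i \<noteq> h j" using h by (auto simp: bij_betw_def inj_on_def)
        have m: "h i \<in> D'" "h j \<in> D'" using ij hD by auto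
        then have "interior (h i) \<inter> interior (h j) = {}"
          using division_ofD(5)[OF D, of "h i" "h j"] hij D'D by blast
        moreover have "interior (h i) = {Inf (h i)<..<Sup (h i)}" "interior (h j) = {Inf (h j)<..<Sup (h j)}"
          using ival m D'D by (metis interior_atLeastAtMost_real subsetD)+
        ultimately have "{max (Inf (h i)) (Inf (h j))<..<min (Sup (h i)) (Sup (h j))} = {}"
          by auto
        then have "min (Sup (h i)) (Sup (h j)) \<le> max (Inf (h i)) (Inf (h j))"
          by (simp add: greaterThanLessThan_empty_iff)
        then show "Sup (h i) \<le> Inf (h j) \<or> Sup (h j) \<le> Inf (h i)"
          using m by (auto simp: D'_def)
      qed
      have "(\<Sum>k<card D'. Sup (h k) - Inf (h k)) = (\<Sum>K\<in>D'. Sup K - Inf K)"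
        by (rule sum.reindex_bij_betw[OF h])
      also have "\<dots> \<le> (\<Sum>K\<in>D. Sup K - Inf K)"
        using finD D'D ival by (intro sum_mono2) auto
      also have "\<dots> = r - l" using sum_increments_division[OF lr(2) D, of "\<lambda>x. x"] by simp
      finally show "(\<Sum>k<card D'. Sup (h k) - Inf (h k)) < d" using lr by simp
    qed
    finally show "(\<Sum>K\<in>D. norm (f (Sup K) - f (Inf K))) < e" .
  qed
qed

text \<open>Absolute continuity bounds the variation by \<open>1\<close> on every interval shorter
  than \<open>d\<close>, and countably many of these, with rational endpoints, cover the open
  interval.\<close>

lemma abs_continuous_on_differentiable_ae_real:
  fixes f :: "real \<Rightarrow> real"
  assumes ac: "abs_continuous_on {a..b} f"
  shows "negligible {t\<in>{a<..<b}. \<nexists>D. (f has_real_derivative D) (at t)}"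
proof -
  obtain d where d: "d > 0"
    "\<And>l r D. {l..r} \<subseteq> {a..b} \<Longrightarrow> l \<le> r \<Longrightarrow> r - l < d \<Longrightarrow> D division_of {l..r} \<Longrightarrow>
       (\<Sum>K\<in>D. norm (f (Sup K) - f (Inf K))) < 1"
    by (rule abs_continuous_on_division[OF ac zero_less_one]) blast
  define Q where "Q = {(l, r). l \<in> \<rat> \<and> r \<in> \<rat> \<and> l < r \<and> {l..r} \<subseteq> {a..b} \<and> r - l < d}"
  define N where "N l r = {t\<in>{l<..<r}. \<nexists>D. (f has_real_derivative D) (at t)}" for l r
  have "countable Q"
    by (rule countable_subset[of _ "\<rat> \<times> \<rat>"]) (auto simp: Q_def countable_rat)
  moreover have "negligible (N l r)" if "(l, r) \<in> Q" for l r
    unfolding N_def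
  proof (rule bounded_variation_differentiable_ae)
    show "l < r" using that by (simp add: Q_def)
    show "continuous_on {l..r} f"
      using that abs_continuous_on_imp_continuous_on[OF ac] by (auto simp: Q_def intro: continuous_on_subset)
    show "\<And>D. D division_of {l..r} \<Longrightarrow> (\<Sum>K\<in>D. \<bar>f (Sup K) - f (Inf K)\<bar>) \<le> 1"
      using d(2)[of l r] that by (force simp: Q_def)
  qed
  ultimately have "negligible (\<Union>(l, r)\<in>Q. N l r)"
    by (intro negligible_countable_Union) auto
  then show ?thesis
  proof (rule negligible_subset, intro subsetI)
    fix t assume t: "t \<in> {t\<in>{a<..<b}. \<nexists>D. (f has_real_derivative D) (at t)}"
    obtain l where l: "l \<in> \<rat>" "max a (t - d / 2) < l" "l < t"
      using Rats_dense_in_real[of "max a (t - d / 2)" t] t d by auto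
    obtain r where r: "r \<in> \<rat>" "t < r" "r < min b (t + d / 2)"
      using Rats_dense_in_real[of t "min b (t + d / 2)"] t d by auto
    have "(l, r) \<in> Q" using l r by (auto simp: Q_def)
    moreover have "t \<in> N l r" using t l r by (auto simp: N_def)
    ultimately show "t \<in> (\<Union>(l, r)\<in>Q. N l r)" by blast
  qed
qed

lemma abs_continuous_on_lipschitz_image:
  fixes f :: "real \<Rightarrow> 'a::real_normed_vector" and g :: "'a \<Rightarrow> 'b::real_normed_vector"
  assumes ac: "abs_continuous_on {a..b} f"
    and lip: "\<And>x y. x \<in> S \<Longrightarrow> y \<in> S \<Longrightarrow> norm (g x - g y) \<le> L * norm (x - y)"
    and S: "\<And>t. t \<in> {a..b} \<Longrightarrow> f t \<in> S"
  shows "abs_continuous_on {a..b} (\<lambda>t. g (f t))"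
  unfolding abs_continuous_on_def
proof (intro allI impI)
  fix e :: real assume e: "e > 0"
  define M where "M = \<bar>L\<bar> + 1"
  have M: "M > 0" by (simp add: M_def)
  have lip': "norm (g x - g y) \<le> M * norm (x - y)" if "x \<in> S" "y \<in> S" for x y
    by (rule order_trans[OF lip[OF that] mult_right_mono]) (auto simp: M_def)
  obtain d where d: "d > 0" and ac: "\<And>(n::nat) (l::nat \<Rightarrow> real) (r::nat \<Rightarrow> real).
        (\<forall>k<n. l k \<le> r k \<and> {l k..r k} \<subseteq> {a..b}) \<Longrightarrow>
        (\<forall>i<n. \<forall>j<n. i \<noteq> j \<longrightarrow> r i \<le> l j \<or> r j \<le> l i) \<Longrightarrow>
        (\<Sum>k<n. r k - l k) < d \<Longrightarrow> (\<Sum>k<n. norm (f (r k) - f (l k))) < e / M"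
    using ac[unfolded abs_continuous_on_def, rule_format, OF divide_pos_pos[OF e M]] by blast
  show "\<exists>\<delta>>0. \<forall>(n::nat) (l::nat \<Rightarrow> real) (r::nat \<Rightarrow> real).
        (\<forall>k<n. l k \<le> r k \<and> {l k..r k} \<subseteq> {a..b}) \<and>
        (\<forall>i<n. \<forall>j<n. i \<noteq> j \<longrightarrow> r i \<le> l j \<or> r j \<le> l i) \<and>
        (\<Sum>k<n. r k - l k) < \<delta>
        \<longrightarrow> (\<Sum>k<n. norm (g (f (r k)) - g (f (l k)))) < e"
  proof (intro exI[of _ d] conjI allI impI d)
    fix n :: nat and l r :: "nat \<Rightarrow> real"
    assume A: "(\<forall>k<n. l k \<le> r k \<and> {l k..r k} \<subseteq> {a..b}) \<and>
        (\<forall>i<n. \<forall>j<n. i \<noteq> j \<longrightarrow> r i \<le> l j \<or> r j \<le> l i) \<and> (\<Sum>k<n. r k - l k) < d"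
    have "(\<Sum>k<n. norm (g (f (r k)) - g (f (l k)))) \<le> (\<Sum>k<n. M * norm (f (r k) - f (l k)))"
      using A by (intro sum_mono lip' S) auto
    also have "\<dots> < e"
      using ac[of n l r] A M by (simp add: sum_distrib_left[symmetric] field_simps)
    finally show "(\<Sum>k<n. norm (g (f (r k)) - g (f (l k)))) < e" .
  qed
qed

lemma abs_continuous_on_differentiable_ae:
  fixes f :: "real \<Rightarrow> 'a::euclidean_space"
  assumes ac: "abs_continuous_on {a..b} f"
  shows "negligible {t\<in>{a<..<b}. \<nexists>v. (f has_vector_derivative v) (at t)}"
proof -
  have "negligible (\<Union>i\<in>(Basis::'a set). {t\<in>{a<..<b}. \<nexists>D. ((\<lambda>t. f t \<bullet> i) has_real_derivative D) (at t)})"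
  proof (intro negligible_Union finite_imageI finite_Basis, clarify)
    fix i :: 'a assume i: "i \<in> Basis"
    have "abs_continuous_on {a..b} (\<lambda>t. f t \<bullet> i)"
      using i by (intro abs_continuous_on_lipschitz_image[OF ac, where S = UNIV and L = 1])
        (auto simp: inner_diff_left[symmetric] Basis_le_norm)
    then show "negligible {t\<in>{a<..<b}. \<nexists>D. ((\<lambda>t. f t \<bullet> i) has_real_derivative D) (at t)}"
      by (rule abs_continuous_on_differentiable_ae_real)
  qed
  then show ?thesis
  proof (rule negligible_subset, intro subsetI)
    let ?U = "\<Union>i\<in>(Basis::'a set). {t\<in>{a<..<b}. \<nexists>D. ((\<lambda>t. f t \<bullet> i) has_real_derivative D) (at t)}"
    fix t assume t: "t \<in> {t\<in>{a<..<b}. \<nexists>v. (f has_vector_derivative v) (at t)}"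
    show "t \<in> ?U"
    proof (rule ccontr)
      assume "t \<notin> ?U"
      then have "\<forall>i\<in>Basis. \<exists>D. ((\<lambda>t. f t \<bullet> i) has_real_derivative D) (at t)"
        using t by blast
      then obtain D where D: "\<And>i. i \<in> Basis \<Longrightarrow> ((\<lambda>t. f t \<bullet> i) has_real_derivative D i) (at t)"
        by metis
      have "(f has_vector_derivative (\<Sum>i\<in>Basis. D i *\<^sub>R i)) (at t)"
        unfolding has_vector_derivative_def
      proof (subst has_derivative_componentwise_within, intro ballI)
        fix i :: 'a assume i: "i \<in> Basis"
        have "((\<lambda>t. f t \<bullet> i) has_derivative (\<lambda>x. D i * x)) (at t)"
          using D[OF i] by (simp add: has_field_derivative_def)
        then show "((\<lambda>x. f x \<bullet> i) has_derivative (\<lambda>x. x *\<^sub>R (\<Sum>i\<in>Basis. D i *\<^sub>R i) \<bullet> i)) (at t)"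
          using i by (simp add: mult.commute)
      qed
      with t show False by blast
    qed
  qed
qed

section \<open>Lipschitz continuity of subsolutions\<close>

lemma superdiffI_touching:
  assumes der: "(\<phi> has_derivative (\<lambda>h. p \<bullet> h)) (at y)" and r: "r > 0"
    and max: "\<And>z. z \<in> V \<Longrightarrow> norm (z - y) < r \<Longrightarrow> u z - \<phi> z \<le> u y - \<phi> y"
  shows "p \<in> superdiff V u y"
  unfolding superdiff_def
proof (intro CollectI allI impI)
  fix e :: real assume "e > 0"
  with der obtain d where d: "d > 0"
    "\<And>z. norm (z - y) < d \<Longrightarrow> norm (\<phi> z - \<phi> y - p \<bullet> (z - y)) \<le> e * norm (z - y)"
    unfolding has_derivative_at_alt by blast
  show "\<exists>\<delta>>0. \<forall>z\<in>V. norm (z - y) < \<delta> \<longrightarrow> u z \<le> u y + p \<bullet> (z - y) + e * norm (z - y)"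
  proof (intro exI[of _ "min d r"] conjI ballI impI)
    fix z assume z: "z \<in> V" "norm (z - y) < min d r"
    then show "u z \<le> u y + p \<bullet> (z - y) + e * norm (z - y)"
      using d(2)[of z] max[of z] by (simp add: abs_le_iff)
  qed (use d r in auto)
qed

text \<open>Coercivity is only pointwise in \<open>x\<close>; convexity makes it uniform. On the
  segment from \<open>0\<close> to a far point of a sublevel set, \<open>H\<close> stays below
  \<open>max (H x 0) 0\<close>. At a fixed radius this bound survives the limit and contradicts
  coercivity at the limit point \<open>x0\<close>.\<close>

lemma uniformly_bounded_sublevels:
  fixes H :: "'a::euclidean_space \<Rightarrow> 'b::euclidean_space \<Rightarrow> real"
  assumes X: "compact X"
    and cont: "continuous_on (X \<times> UNIV) (\<lambda>(x, p). H x p)"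
    and conv: "\<forall>x\<in>X. convex_on UNIV (H x)"
    and coer: "\<forall>x\<in>X. filterlim (H x) at_top at_infinity"
  obtains R where "R > 0" "\<And>x p. x \<in> X \<Longrightarrow> H x p \<le> 0 \<Longrightarrow> norm p \<le> R"
proof (rule ccontr)
  assume "\<not> thesis"
  then have "\<exists>x p. x \<in> X \<and> H x p \<le> 0 \<and> norm p > real n + 1" for n :: nat
    using that[of "real n + 1"] by (force simp: not_le)
  then obtain x p where xp: "\<And>n::nat. x n \<in> X" "\<And>n. H (x n) (p n) \<le> 0" "\<And>n. norm (p n) > real n + 1"
    by metis
  have pn: "norm (p n) > 0" for n using xp(3)[of n] by linarith
  define e where "e n = p n /\<^sub>R norm (p n)" for n
  have "\<forall>n. (x n, e n) \<in> X \<times> sphere 0 1"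
    using xp(1) pn by (auto simp: e_def)
  then obtain l \<sigma> where l: "l \<in> X \<times> sphere 0 1" "strict_mono \<sigma>" "((\<lambda>n. (x n, e n)) \<circ> \<sigma>) \<longlonglongrightarrow> l"
    using seq_compactE[OF compact_imp_seq_compact[OF compact_Times[OF X compact_sphere[of 0 1]]],
        of "\<lambda>n. (x n, e n)"] by blast
  obtain x0 e0 where l0: "l = (x0, e0)" by (cases l)
  have lim: "(\<lambda>n. x (\<sigma> n)) \<longlonglongrightarrow> x0" "(\<lambda>n. e (\<sigma> n)) \<longlonglongrightarrow> e0"
    using tendsto_fst[OF l(3)] tendsto_snd[OF l(3)] by (simp_all add: l0 o_def)
  have x0: "x0 \<in> X" "norm e0 = 1" using l(1) by (auto simp: l0)
  obtain b where b: "\<And>q. norm q \<ge> b \<Longrightarrow> H x0 q > max (H x0 0) 0"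
    using filterlim_at_top_dense[of "H x0" at_infinity] coer x0
    unfolding eventually_at_infinity by blast
  define r where "r = max b 1"
  have r: "r > 0" "r \<ge> b" by (auto simp: r_def)
  have cH: "(\<lambda>n. H (x (\<sigma> n)) (q n)) \<longlonglongrightarrow> H x0 q0" if "q \<longlonglongrightarrow> q0" for q q0
    using continuous_on_tendsto_compose[OF cont tendsto_Pair[OF lim(1) that]] x0 xp(1) by auto
  have "H x0 (r *\<^sub>R e0) \<le> max (H x0 0) 0"
  proof (rule tendsto_le[OF _ tendsto_max[OF cH[OF tendsto_const] tendsto_const] cH])
    show "(\<lambda>n. r *\<^sub>R e (\<sigma> n)) \<longlonglongrightarrow> r *\<^sub>R e0" by (intro tendsto_intros lim)
    obtain N :: nat where N: "real N > r" using reals_Archimedean2 by blast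
    show "\<forall>\<^sub>F n in sequentially. H (x (\<sigma> n)) (r *\<^sub>R e (\<sigma> n)) \<le> max (H (x (\<sigma> n)) 0) 0"
      unfolding eventually_sequentially
    proof (intro exI[of _ N] allI impI)
      fix n assume "N \<le> n"
      define m where "m = \<sigma> n"
      have "m \<ge> N" using seq_suble[OF l(2), of n] \<open>N \<le> n\<close> by (simp add: m_def)
      then have nr: "norm (p m) > r" using xp(3)[of m] N by linarith
      define t where "t = r / norm (p m)"
      have t: "0 \<le> t" "t \<le> 1" using nr r pn[of m] by (auto simp: t_def)
      have "convex_on UNIV (H (x m))" using conv xp(1) by blast
      from convex_onD[OF this, of t 0 "p m"] t
      have "H (x m) (t *\<^sub>R p m) \<le> (1 - t) * H (x m) 0 + t * H (x m) (p m)" by simp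
      also have "\<dots> \<le> (1 - t) * max (H (x m) 0) 0 + t * max (H (x m) 0) 0"
        using t xp(2)[of m] by (intro add_mono mult_left_mono) auto
      also have "\<dots> = max (H (x m) 0) 0" by (simp add: algebra_simps)
      finally show "H (x (\<sigma> n)) (r *\<^sub>R e (\<sigma> n)) \<le> max (H (x (\<sigma> n)) 0) 0"
        by (simp add: m_def e_def t_def divide_inverse)
    qed
  qed simp
  moreover have "norm (r *\<^sub>R e0) \<ge> b" using r x0 by simp
  ultimately show False using b by fastforce
qed

text \<open>A maximum point of \<open>u - \<phi>\<close> other than \<open>x\<close> would lie in
  \<open>\<Omega>\<close> and carry the gradient of \<open>\<phi>\<close>, whose norm exceeds
  \<open>R\<close>. The quadratic coefficient makes \<open>\<phi>\<close> exceed
  \<open>2 * M\<close>, the oscillation bound of \<open>u\<close>, at distance \<open>r\<close>;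
  this keeps the maximum point in the ball.\<close>

lemma interior_growth:
  fixes u :: "'a::euclidean_space \<Rightarrow> real"
  assumes S: "compact S" and cont: "continuous_on S u" and OS: "\<Omega> \<subseteq> S"
    and grad: "\<forall>x\<in>\<Omega>. \<forall>p\<in>superdiff S u x. norm p \<le> R"
    and M: "\<And>x. x \<in> S \<Longrightarrow> \<bar>u x\<bar> \<le> M"
    and r: "r > 0" and ball: "ball x r \<subseteq> \<Omega>" and z: "z \<in> S" and R: "R > 0"
  shows "u z \<le> u x + (R + 1) * norm (z - x) + (2 * M + 1) / r\<^sup>2 * (norm (z - x))\<^sup>2"
proof -
  define B where "B = (2 * M + 1) / r\<^sup>2"
  define \<phi> where "\<phi> y = (R + 1) * norm (y - x) + B * ((y - x) \<bullet> (y - x))" for y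
  have xO: "x \<in> \<Omega>" using ball r by auto
  then have xS: "x \<in> S" using OS by blast
  have M0: "M \<ge> 0" using M[OF xS] by linarith
  have B: "B > 0" using M0 r by (simp add: B_def)
  have "continuous_on S (\<lambda>y. u y - \<phi> y)"
    unfolding \<phi>_def by (intro continuous_intros cont)
  from continuous_attains_sup[OF S _ this] xS
  obtain y where y: "y \<in> S" "\<And>w. w \<in> S \<Longrightarrow> u w - \<phi> w \<le> u y - \<phi> y" by blast
  have "y = x"
  proof (rule ccontr)
    assume "y \<noteq> x"
    have "\<phi> y \<le> u y - u x" using y(2)[OF xS] by (simp add: \<phi>_def)
    also have "\<dots> \<le> 2 * M" using M[OF xS] M[OF y(1)] by linarith
    finally have "B * (norm (y - x))\<^sup>2 \<le> 2 * M"
      using R by (simp add: \<phi>_def power2_norm_eq_inner add_nonneg_nonneg)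
        (smt (verit) mult_nonneg_nonneg norm_ge_zero)
    also have "\<dots> < B * r\<^sup>2" using r by (simp add: B_def)
    finally have "norm (y - x) < r" using B r by (simp add: power2_less_imp_less)
    then have yO: "y \<in> \<Omega>" using ball by (auto simp: dist_norm norm_minus_commute)
    define p where "p = ((R + 1) / norm (y - x) + 2 * B) *\<^sub>R (y - x)"
    have "((\<lambda>z. z - x) has_derivative (\<lambda>h. h)) (at y)"
      by (auto intro!: derivative_eq_intros)
    from has_derivative_compose[OF this has_derivative_norm] \<open>y \<noteq> x\<close>
    have dn: "((\<lambda>z. norm (z - x)) has_derivative (\<lambda>h. ((y - x) \<bullet> h) / norm (y - x))) (at y)"
      by (simp add: sgn_div_norm inner_commute divide_inverse mult.commute)
    have "(\<phi> has_derivative (\<lambda>h. (R + 1) * (((y - x) \<bullet> h) / norm (y - x)) + B * ((y - x) \<bullet> h + h \<bullet> (y - x)))) (at y)"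
      unfolding \<phi>_def
      by (intro has_derivative_add has_derivative_mult_right has_derivative_inner dn)
         (auto intro!: derivative_eq_intros)
    moreover have "(\<lambda>h. (R + 1) * (((y - x) \<bullet> h) / norm (y - x)) + B * ((y - x) \<bullet> h + h \<bullet> (y - x))) = (\<lambda>h. p \<bullet> h)"
      unfolding p_def inner_scaleR_left inner_commute[of _ "y - x"] by (simp add: distrib_right mult.assoc mult.left_commute)
    ultimately have "(\<phi> has_derivative (\<lambda>h. p \<bullet> h)) (at y)" by simp
    from superdiffI_touching[OF this zero_less_one, of S u] y(2)
    have "p \<in> superdiff S u y" by blast
    then have "norm p \<le> R" using grad yO by blast
    moreover have "norm p = R + 1 + 2 * B * norm (y - x)"
    proof -
      have "(R + 1) / norm (y - x) + 2 * B > 0" using R B by (intro add_nonneg_pos) auto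
      then have "norm p = ((R + 1) / norm (y - x) + 2 * B) * norm (y - x)" by (simp add: p_def)
      also have "\<dots> = R + 1 + 2 * B * norm (y - x)" using \<open>y \<noteq> x\<close> by (simp add: field_simps)
      finally show ?thesis .
    qed
    ultimately show False using B by (smt (verit) mult_nonneg_nonneg norm_ge_zero)
  qed
  then show ?thesis using y(2)[OF z] by (simp add: \<phi>_def B_def power2_norm_eq_inner)
qed

text \<open>Chaining the growth estimate over \<open>n + 1\<close> equal pieces divides the
  quadratic error by \<open>n + 1\<close>. One radius serves all pieces because the segment is
  compact.\<close>

lemma segment_lipschitz:
  fixes u :: "'a::euclidean_space \<Rightarrow> real"
  assumes S: "compact S" and cont: "continuous_on S u" and OS: "\<Omega> \<subseteq> S" and op: "open \<Omega>"
    and grad: "\<forall>x\<in>\<Omega>. \<forall>p\<in>superdiff S u x. norm p \<le> R" and R: "R > 0"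
    and seg: "closed_segment x y \<subseteq> \<Omega>"
  shows "u y - u x \<le> (R + 1) * norm (y - x)"
proof -
  obtain M where M: "\<And>x. x \<in> S \<Longrightarrow> \<bar>u x\<bar> \<le> M"
    using compact_imp_bounded[OF compact_continuous_image[OF cont S]] unfolding bounded_iff by auto
  obtain r where r: "r > 0" "(\<Union>z\<in>closed_segment x y. ball z r) \<subseteq> \<Omega>"
    using compact_subset_open_imp_ball_epsilon_subset[OF compact_segment op seg] by blast
  define B where "B = (2 * M + 1) / r\<^sup>2"
  have step: "u z \<le> u w + (R + 1) * norm (z - w) + B * (norm (z - w))\<^sup>2"
    if "w \<in> closed_segment x y" "z \<in> closed_segment x y" for w z
    unfolding B_def using that r seg OS
    by (intro interior_growth[OF S cont OS grad M r(1) _ _ R]) auto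
  have "u y - u x \<le> (R + 1) * norm (y - x) + B * (norm (y - x))\<^sup>2 * inverse (real (Suc n))" for n
  proof -
    let ?N = "real (Suc n)"
    define z where "z k = x + (real k / ?N) *\<^sub>R (y - x)" for k
    have zin: "z k \<in> closed_segment x y" if "k \<le> Suc n" for k
      unfolding closed_segment_def z_def using that
      by (auto intro!: exI[of _ "real k / ?N"] simp: algebra_simps)
    have zd: "norm (z (Suc k) - z k) = norm (y - x) / ?N" for k
    proof -
      have "z (Suc k) - z k = (real (Suc k) / ?N - real k / ?N) *\<^sub>R (y - x)"
        unfolding z_def scaleR_left_diff_distrib by simp
      also have "real (Suc k) / ?N - real k / ?N = 1 / ?N"
        unfolding diff_divide_distrib[symmetric] by simp
      finally show ?thesis by (simp del: of_nat_Suc)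
    qed
    have "u y - u x = (\<Sum>k<Suc n. u (z (Suc k)) - u (z k))"
      using sum_lessThan_telescope[of "\<lambda>k. u (z k)" "Suc n"]
      by (simp add: z_def del: sum.lessThan_Suc of_nat_Suc)
    also have "\<dots> \<le> (\<Sum>k<Suc n. (R + 1) * (norm (y - x) / ?N) + B * (norm (y - x) / ?N)\<^sup>2)"
    proof (rule sum_mono)
      fix k assume "k \<in> {..<Suc n}"
      then show "u (z (Suc k)) - u (z k) \<le> (R + 1) * (norm (y - x) / ?N) + B * (norm (y - x) / ?N)\<^sup>2"
        using step[of "z k" "z (Suc k)"] zin[of k] zin[of "Suc k"] unfolding zd by simp
    qed
    also have "\<dots> = ?N * ((R + 1) * (norm (y - x) / ?N) + B * (norm (y - x) / ?N)\<^sup>2)"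
      by simp
    also have "\<dots> = (R + 1) * norm (y - x) + B * (norm (y - x))\<^sup>2 * inverse ?N"
      by (simp add: field_simps power2_eq_square del: of_nat_Suc)
    finally show ?thesis .
  qed
  moreover have "(\<lambda>n. (R + 1) * norm (y - x) + B * (norm (y - x))\<^sup>2 * inverse (real (Suc n)))
      \<longlonglongrightarrow> (R + 1) * norm (y - x) + B * (norm (y - x))\<^sup>2 * 0"
    by (intro tendsto_intros LIMSEQ_inverse_real_of_nat)
  ultimately show ?thesis
    by (intro tendsto_lowerbound[of _ _ sequentially "u y - u x"]) auto
qed

section \<open>Lipschitz bounds up to the boundary\<close>

lemma mvt_gradient:
  fixes \<rho> :: "'a::euclidean_space \<Rightarrow> real"
  assumes "\<And>x. (\<rho> has_derivative (\<lambda>h. D\<rho> x \<bullet> h)) (at x)"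
  obtains \<tau> where "0 < \<tau>" "\<tau> < 1" "\<rho> (x + w) - \<rho> x = D\<rho> (x + \<tau> *\<^sub>R w) \<bullet> w"
proof -
  have "((\<lambda>t. \<rho> (x + t *\<^sub>R w)) has_derivative (\<lambda>s. D\<rho> (x + t *\<^sub>R w) \<bullet> (s *\<^sub>R w))) (at t within {0..1})" for t
    by (rule has_derivative_compose[OF _ assms]) (auto intro!: derivative_eq_intros)
  from mvt_simple[OF zero_less_one this] show thesis
    by (auto intro: that)
qed


lemma nonpos_on_closure:
  fixes \<rho> :: "'a::euclidean_space \<Rightarrow> real"
  assumes der: "\<And>x. (\<rho> has_derivative (\<lambda>h. D\<rho> x \<bullet> h)) (at x)"
    and dom: "\<Omega> = {x. \<rho> x < 0}" and x: "x \<in> closure \<Omega>"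
  shows "\<rho> x \<le> 0"
proof -
  have "continuous_on UNIV \<rho>"
    using der by (auto simp: continuous_on_eq_continuous_at intro: has_derivative_continuous)
  then have "closed {x. \<rho> x \<le> 0}" by (intro closed_Collect_le) auto
  then have "closure \<Omega> \<subseteq> {x. \<rho> x \<le> 0}" by (intro closure_minimal) (auto simp: dom)
  then show ?thesis using x by blast
qed

text \<open>Two points near the boundary are joined inside \<^term>\<open>\<Omega>\<close> by moving inwards along the normal by a
  multiple of their distance, across, and back.\<close>

lemma lipschitz_near_boundary:
  fixes u \<rho> :: "'a::euclidean_space \<Rightarrow> real"
  assumes bd: "bounded \<Omega>" and op: "open \<Omega>" and cont: "continuous_on (closure \<Omega>) u"
    and grad: "\<forall>x\<in>\<Omega>. \<forall>p\<in>superdiff (closure \<Omega>) u x. norm p \<le> R" and R: "R > 0"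
    and der: "\<And>x. (\<rho> has_derivative (\<lambda>h. D\<rho> x \<bullet> h)) (at x)" and C1: "continuous_on UNIV D\<rho>"
    and dom: "\<Omega> = {x. \<rho> x < 0}" and nz: "D\<rho> x0 \<noteq> 0"
  shows "\<exists>r>0. \<exists>L\<ge>0. \<forall>x\<in>closure \<Omega> \<inter> ball x0 r. \<forall>y\<in>closure \<Omega> \<inter> ball x0 r. u y - u x \<le> L * norm (y - x)"
proof -
  define n where "n = D\<rho> x0"
  \<comment> \<open>Where \<open>D\<rho>\<close> differs from \<open>n\<close> by less than
    \<open>norm n / 2\<close>, \<open>\<theta>\<close> bounds \<open>D\<rho> \<bullet> n\<close>
    from below and \<open>M\<close> bounds the norm of \<open>D\<rho>\<close>. \<open>K\<close> is
    chosen so that descending by \<open>K * norm (y - x)\<close> along \<open>- n\<close> outweighs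
    any displacement of size \<open>norm (y - x)\<close>.\<close>
  define \<theta> where "\<theta> = (norm n)\<^sup>2 / 2"
  define M where "M = 2 * norm n"
  define K where "K = (M + 1) / \<theta>"
  have n: "norm n > 0" using nz by (simp add: n_def)
  then have th: "\<theta> > 0" and M0: "M > 0" by (auto simp: \<theta>_def M_def)
  then have K: "K > 0" "\<theta> * K = M + 1" by (auto simp: K_def)
  have S: "compact (closure \<Omega>)" using bd by simp
  note \<rho>0 = nonpos_on_closure[OF der dom]
  obtain r1 where r1: "r1 > 0" "\<And>y. dist y x0 < r1 \<Longrightarrow> norm (D\<rho> y - n) < norm n / 2"
    using C1 n unfolding continuous_on_iff n_def dist_norm by (metis UNIV_I half_gt_zero)
  have bnd: "D\<rho> y \<bullet> n \<ge> \<theta>" "norm (D\<rho> y) \<le> M" if "dist y x0 < r1" for y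
  proof -
    have "(n - D\<rho> y) \<bullet> n \<le> norm (n - D\<rho> y) * norm n" by (rule norm_cauchy_schwarz)
    also have "\<dots> \<le> norm n / 2 * norm n"
      using r1(2)[OF that] by (intro mult_right_mono) (auto simp: norm_minus_commute)
    finally show "D\<rho> y \<bullet> n \<ge> \<theta>"
      by (simp add: \<theta>_def inner_diff_left power2_norm_eq_inner[symmetric] power2_eq_square)
    have "norm (D\<rho> y) \<le> norm (D\<rho> y - n) + norm n"
      using norm_triangle_ineq[of "D\<rho> y - n" n] by simp
    then show "norm (D\<rho> y) \<le> M" using r1(2)[OF that] n unfolding M_def by linarith
  qed
  \<comment> \<open>At the mean value point the descent contributes at most
    \<open>- \<theta> * h\<close> to \<open>\<rho>\<close>, and the displacement from
    \<open>x\<close> to \<open>z\<close> at most \<open>M * norm (z - x)\<close>.\<close>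
  have down: "z - h *\<^sub>R n \<in> \<Omega>" if x: "x \<in> closure \<Omega>" "dist x x0 < r1" and z: "dist (z - h *\<^sub>R n) x0 < r1"
    and h: "h \<ge> 0" "M * norm (z - x) < \<theta> * h" for x z h
  proof -
    define w where "w = z - h *\<^sub>R n - x"
    obtain \<tau> where t: "0 < \<tau>" "\<tau> < 1" "\<rho> (x + w) - \<rho> x = D\<rho> (x + \<tau> *\<^sub>R w) \<bullet> w"
      using mvt_gradient[OF der] by blast
    define \<xi> where "\<xi> = x + \<tau> *\<^sub>R w"
    have "\<xi> \<in> ball x0 r1"
    proof -
      have "\<xi> = (1 - \<tau>) *\<^sub>R x + \<tau> *\<^sub>R (z - h *\<^sub>R n)" by (simp add: \<xi>_def w_def algebra_simps)
      then show ?thesis using convexD_alt[OF convex_ball, of x x0 r1 "z - h *\<^sub>R n" \<tau>] x z t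
        by (simp add: dist_commute)
    qed
    then have b: "D\<rho> \<xi> \<bullet> n \<ge> \<theta>" "norm (D\<rho> \<xi>) \<le> M" using bnd[of \<xi>] by (auto simp: dist_commute)
    have "\<rho> (z - h *\<^sub>R n) = \<rho> x + D\<rho> \<xi> \<bullet> (z - x) - h * (D\<rho> \<xi> \<bullet> n)"
      using t(3) by (simp add: w_def \<xi>_def inner_diff_right)
    moreover have "D\<rho> \<xi> \<bullet> (z - x) \<le> M * norm (z - x)"
      using norm_cauchy_schwarz[of "D\<rho> \<xi>" "z - x"] mult_right_mono[OF b(2), of "norm (z - x)"] by simp
    moreover have "h * (D\<rho> \<xi> \<bullet> n) \<ge> h * \<theta>" using b h by (intro mult_left_mono) auto
    ultimately have "\<rho> (z - h *\<^sub>R n) < 0" using \<rho>0[OF x(1)] h(2) by (simp add: mult.commute)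
    then show ?thesis by (simp add: dom)
  qed
  \<comment> \<open>\<open>norm (y - x)\<close> is below \<open>2 * r\<close>, so the descent has
    length at most \<open>2 * K * r * norm n\<close>; this \<open>r\<close> keeps the whole path in
    the ball of radius \<open>r1\<close>.\<close>
  define r where "r = r1 / (2 + 2 * K * norm n)"
  have dpos: "2 + 2 * K * norm n > 0" using K n by (intro add_pos_nonneg) auto
  have r: "r > 0" using r1 dpos by (simp add: r_def)
  have rr: "r + K * (2 * r) * norm n < r1"
  proof -
    have "r * (2 + 2 * K * norm n) = r1" using dpos by (simp add: r_def)
    then show ?thesis using r by (simp add: algebra_simps)
  qed
  \<comment> \<open>Two legs along \<open>n\<close>, each of length at most
    \<open>K * norm n * norm (y - x)\<close>, and one leg across.\<close>
  define L where "L = (R + 1) * (2 * K * norm n + 1)"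
  have L: "L \<ge> 0" using R K n by (simp add: L_def)
  have "u y - u x \<le> L * norm (y - x)"
    if x: "x \<in> closure \<Omega>" "dist x x0 < r" and y: "y \<in> closure \<Omega>" "dist y x0 < r" for x y
  proof (cases "x = y")
    case False
    define h where "h = K * norm (y - x)"
    have h: "h > 0" using False K by (simp add: h_def)
    have "norm (y - x) < 2 * r" using x y by (metis dist_norm dist_commute dist_triangle_half_l mult_2 nonzero_mult_div_cancel_left zero_neq_numeral)
    then have hn: "h * norm n \<le> K * (2 * r) * norm n"
      using K n unfolding h_def by (intro mult_right_mono mult_left_mono) auto
    have near: "dist (z - s *\<^sub>R n) x0 < r1" if "dist z x0 < r" "0 \<le> s" "s \<le> h" for z s
    proof -
      have "dist (z - s *\<^sub>R n) x0 \<le> norm (z - x0) + s * norm n"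
        using norm_triangle_ineq4[of "z - x0" "s *\<^sub>R n"] that by (simp add: dist_norm algebra_simps)
      also have "\<dots> < r + h * norm n" using that n by (intro add_less_le_mono mult_right_mono) (auto simp: dist_norm)
      finally show ?thesis using hn rr by linarith
    qed
    have xr1: "dist x x0 < r1" "dist y x0 < r1" using near[of x 0] near[of y 0] x y h by auto
    \<comment> \<open>The leg starts at depth \<open>s > 0\<close> because \<open>w\<close> may lie
      on the boundary; \<open>s\<close> tends to \<open>0\<close> at the end, by continuity of
      \<open>u\<close>.\<close>
    have vert: "closed_segment (w - s *\<^sub>R n) (w - h *\<^sub>R n) \<subseteq> \<Omega>"
      if w: "w \<in> closure \<Omega>" "dist w x0 < r" "dist w x0 < r1" and s: "0 < s" "s \<le> h" for w s
    proof
      fix z assume "z \<in> closed_segment (w - s *\<^sub>R n) (w - h *\<^sub>R n)"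
      then obtain t where t: "0 \<le> t" "t \<le> 1" "z = (1 - t) *\<^sub>R (w - s *\<^sub>R n) + t *\<^sub>R (w - h *\<^sub>R n)"
        by (auto simp: closed_segment_def)
      define s' where "s' = (1 - t) * s + t * h"
      have z: "z = w - s' *\<^sub>R n" using t by (simp add: s'_def algebra_simps)
      have "s \<le> s'" "s' \<le> h"
        using convex_bound_le[of s h h "1 - t" t] convex_bound_le[of "- s" "- s" "- h" "1 - t" t] s t
        by (auto simp: s'_def)
      then show "z \<in> \<Omega>" unfolding z using s th w
        by (intro down[OF w(1,3)] near) auto
    qed
    have horiz: "closed_segment (x - h *\<^sub>R n) (y - h *\<^sub>R n) \<subseteq> \<Omega>"
    proof
      fix z assume "z \<in> closed_segment (x - h *\<^sub>R n) (y - h *\<^sub>R n)"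
      then obtain t where t: "0 \<le> t" "t \<le> 1" "z = (1 - t) *\<^sub>R (x - h *\<^sub>R n) + t *\<^sub>R (y - h *\<^sub>R n)"
        by (auto simp: closed_segment_def)
      define z' where "z' = (1 - t) *\<^sub>R x + t *\<^sub>R y"
      have z: "z = z' - h *\<^sub>R n" using t by (simp add: z'_def algebra_simps)
      have "z' \<in> ball x0 r"
        using convexD_alt[OF convex_ball, of x x0 r y t] x y t by (simp add: z'_def dist_commute)
      then have z'r: "dist z' x0 < r" by (simp add: dist_commute)
      have "z' - x = t *\<^sub>R (y - x)" by (simp add: z'_def algebra_simps)
      then have "norm (z' - x) \<le> norm (y - x)" using t by (simp add: mult_left_le_one_le)
      then have "M * norm (z' - x) \<le> M * norm (y - x)" using M0 by simp
      also have "\<dots> < (M + 1) * norm (y - x)" using False by simp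
      also have "\<dots> = \<theta> * h" using K(2) by (simp add: h_def mult.assoc[symmetric])
      finally show "z \<in> \<Omega>" unfolding z using h
        by (intro down[OF x(1) xr1(1)] near z'r) auto
    qed
    note seg = segment_lipschitz[OF S cont closure_subset op grad R]
    have bound: "u (y - s *\<^sub>R n) - u (x - s *\<^sub>R n) \<le> L * norm (y - x)" if s: "0 < s" "s \<le> h" for s
    proof -
      have "u (x - h *\<^sub>R n) - u (x - s *\<^sub>R n) \<le> (R + 1) * norm (x - h *\<^sub>R n - (x - s *\<^sub>R n))"
        by (rule seg[OF vert[OF x xr1(1) s]])
      moreover have "u (y - h *\<^sub>R n) - u (x - h *\<^sub>R n) \<le> (R + 1) * norm (y - h *\<^sub>R n - (x - h *\<^sub>R n))"
        by (rule seg[OF horiz])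
      moreover have "u (y - s *\<^sub>R n) - u (y - h *\<^sub>R n) \<le> (R + 1) * norm (y - s *\<^sub>R n - (y - h *\<^sub>R n))"
        by (rule seg[OF vert[OF y xr1(2) s, unfolded closed_segment_commute[of "y - s *\<^sub>R n"]]])
      moreover have "norm (x - h *\<^sub>R n - (x - s *\<^sub>R n)) \<le> h * norm n" "norm (y - s *\<^sub>R n - (y - h *\<^sub>R n)) \<le> h * norm n"
      proof -
        have "x - h *\<^sub>R n - (x - s *\<^sub>R n) = (s - h) *\<^sub>R n" "y - s *\<^sub>R n - (y - h *\<^sub>R n) = (h - s) *\<^sub>R n"
          by (simp_all add: algebra_simps)
        then show "norm (x - h *\<^sub>R n - (x - s *\<^sub>R n)) \<le> h * norm n" "norm (y - s *\<^sub>R n - (y - h *\<^sub>R n)) \<le> h * norm n"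
          using s by (simp_all add: mult_right_mono)
      qed
      ultimately have "u (y - s *\<^sub>R n) - u (x - s *\<^sub>R n) \<le> (R + 1) * (h * norm n) + (R + 1) * norm (y - x) + (R + 1) * (h * norm n)"
        using R by (smt (verit) add_diff_cancel_right diff_add_cancel diff_diff_eq2 mult_left_mono)
      also have "\<dots> = L * norm (y - x)" by (simp add: L_def h_def algebra_simps)
      finally show ?thesis .
    qed
    have lim: "((\<lambda>s. u (w - s *\<^sub>R n)) \<longlongrightarrow> u w) (at_right 0)"
      if w: "w \<in> closure \<Omega>" "dist w x0 < r" "dist w x0 < r1" for w
    proof (rule continuous_on_tendsto_compose[OF cont])
      show "((\<lambda>s. w - s *\<^sub>R n) \<longlongrightarrow> w) (at_right 0)"
        by (auto intro!: tendsto_eq_intros)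
      show "\<forall>\<^sub>F s in at_right 0. w - s *\<^sub>R n \<in> closure \<Omega>"
        unfolding eventually_at_right_field
      proof (intro exI[of _ h] conjI allI impI h)
        fix s assume "0 < s" "s < h"
        then have "w - s *\<^sub>R n \<in> \<Omega>" using vert[OF w, of s] by auto
        then show "w - s *\<^sub>R n \<in> closure \<Omega>" using closure_subset by blast
      qed
    qed (rule w)
    show ?thesis
    proof (rule tendsto_upperbound[OF tendsto_diff[OF lim[OF y xr1(2)] lim[OF x xr1(1)]]])
      show "\<forall>\<^sub>F s in at_right 0. u (y - s *\<^sub>R n) - u (x - s *\<^sub>R n) \<le> L * norm (y - x)"
        unfolding eventually_at_right_field using bound h by (intro exI[of _ h]) auto
    qed simp
  qed simp
  then show ?thesis using r L by (intro exI[of _ r] exI[of _ L] conjI) (auto simp: dist_commute)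
qed

lemma lipschitz_on_closure:
  fixes u \<rho> :: "'a::euclidean_space \<Rightarrow> real"
  assumes bd: "bounded \<Omega>" and op: "open \<Omega>" and cont: "continuous_on (closure \<Omega>) u"
    and grad: "\<forall>x\<in>\<Omega>. \<forall>p\<in>superdiff (closure \<Omega>) u x. norm p \<le> R" and R: "R > 0"
    and der: "\<And>x. (\<rho> has_derivative (\<lambda>h. D\<rho> x \<bullet> h)) (at x)" and C1: "continuous_on UNIV D\<rho>"
    and dom: "\<Omega> = {x. \<rho> x < 0}" and nz: "\<And>x. x \<in> frontier \<Omega> \<Longrightarrow> D\<rho> x \<noteq> 0"
  obtains L where "L-lipschitz_on (closure \<Omega>) u"
proof -
  have S: "compact (closure \<Omega>)" using bd by simp
  have loc: "\<exists>r>0. \<exists>L\<ge>0. \<forall>x\<in>closure \<Omega> \<inter> ball x0 r. \<forall>y\<in>closure \<Omega> \<inter> ball x0 r. u y - u x \<le> L * norm (y - x)"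
    if x0: "x0 \<in> closure \<Omega>" for x0
  proof (cases "x0 \<in> \<Omega>")
    case True
    then obtain r where r: "r > 0" "ball x0 r \<subseteq> \<Omega>" using op open_contains_ball by blast
    have "u y - u x \<le> (R + 1) * norm (y - x)" if "x \<in> ball x0 r" "y \<in> ball x0 r" for x y
      using that r closed_segment_subset[of x "ball x0 r" y]
      by (intro segment_lipschitz[OF S cont closure_subset op grad R]) auto
    then show ?thesis using r R by (intro exI[of _ r] conjI exI[of _ "R + 1"]) auto
  next
    case False
    then have "x0 \<in> frontier \<Omega>" using x0 op by (simp add: frontier_def interior_open)
    from lipschitz_near_boundary[OF bd op cont grad R der C1 dom nz[OF this]]
    show ?thesis by blast
  qed
  \<comment> \<open>The passage from local to global on a compact set is stated for time-dependent
    maps, hence the dummy time \<open>0\<close>.\<close>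
  have "local_lipschitz {0::real} (closure \<Omega>) (\<lambda>_. u)"
    unfolding local_lipschitz_def
  proof (intro ballI)
    fix x0 t assume "x0 \<in> closure \<Omega>" "t \<in> {0::real}"
    from loc[OF this(1)] obtain r L where r: "r > 0" "L \<ge> 0"
      "\<And>x y. x \<in> closure \<Omega> \<inter> ball x0 r \<Longrightarrow> y \<in> closure \<Omega> \<inter> ball x0 r \<Longrightarrow> u y - u x \<le> L * norm (y - x)"
      by blast
    have "L-lipschitz_on (cball x0 (r / 2) \<inter> closure \<Omega>) u"
    proof (rule lipschitz_onI)
      fix x y assume "x \<in> cball x0 (r / 2) \<inter> closure \<Omega>" "y \<in> cball x0 (r / 2) \<inter> closure \<Omega>"
      then have "x \<in> closure \<Omega> \<inter> ball x0 r" "y \<in> closure \<Omega> \<inter> ball x0 r" using r(1) by auto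
      from r(3)[OF this] r(3)[OF this(2,1)]
      show "dist (u x) (u y) \<le> L * dist x y" by (auto simp: dist_real_def dist_norm norm_minus_commute)
    qed (rule r)
    then show "\<exists>ua>0. \<exists>L. \<forall>t\<in>cball t ua \<inter> {0}. L-lipschitz_on (cball x0 ua \<inter> closure \<Omega>) u"
      using r(1) by (intro exI[of _ "r / 2"]) auto
  qed
  then show thesis
    by (rule local_lipschitz_compact_implies_lipschitz[OF _ S, of "{0}"]) (auto intro: that)
qed

section \<open>Contact points of oblique test functions\<close>

text \<open>One-sided penalties must stay differentiable where they switch on: the remainder is at
  most \<open>(y - t)\<^sup>2\<close> at every point, the corner included.\<close>

lemma has_real_derivative_pos_part_square:
  "((\<lambda>t. (max 0 t)\<^sup>2) has_real_derivative 2 * max 0 t) (at t)"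
  unfolding has_field_derivative_def has_derivative_at_alt
proof (intro conjI allI impI)
  show "bounded_linear ((*) (2 * max 0 t))" by (rule bounded_linear_mult_right)
  have *: "\<bar>(max 0 y)\<^sup>2 - (max 0 t)\<^sup>2 - 2 * max 0 t * (y - t)\<bar> \<le> (y - t)\<^sup>2" for y
  proof -
    consider "0 \<le> t" "0 \<le> y" | "0 \<le> t" "y < 0" | "t < 0" "0 \<le> y" | "t < 0" "y < 0" by linarith
    then show ?thesis
    proof cases
      case 1
      have "y\<^sup>2 - t\<^sup>2 - 2 * t * (y - t) = (y - t)\<^sup>2" by (simp add: power2_eq_square algebra_simps)
      then show ?thesis using 1 by (simp add: max_absorb2)
    next
      case 2
      have "t * y \<le> 0" using 2 by (simp add: mult_nonneg_nonpos)
      moreover have "0 - t\<^sup>2 - 2 * t * (y - t) = t\<^sup>2 - 2 * (t * y)" "(y - t)\<^sup>2 = y\<^sup>2 + t\<^sup>2 - 2 * (t * y)"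
        by (simp_all add: power2_eq_square algebra_simps)
      moreover have "\<bar>t\<^sup>2 - 2 * (t * y)\<bar> = t\<^sup>2 - 2 * (t * y)"
        using \<open>t * y \<le> 0\<close> zero_le_power2[of t] by linarith
      ultimately show ?thesis using 2 by (simp add: max_absorb1 max_absorb2)
    next
      case 3
      then have "y\<^sup>2 \<le> (y - t)\<^sup>2" by (intro power_mono) auto
      then show ?thesis using 3 by (simp add: max_def)
    next
      case 4
      then show ?thesis by (simp add: max_def)
    qed
  qed
  fix e :: real assume e: "e > 0"
  show "\<exists>d>0. \<forall>y. norm (y - t) < d \<longrightarrow>
      norm ((max 0 y)\<^sup>2 - (max 0 t)\<^sup>2 - 2 * max 0 t * (y - t)) \<le> e * norm (y - t)"
  proof (intro exI[of _ e] conjI allI impI e)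
    fix y assume "norm (y - t) < e"
    then have "(y - t)\<^sup>2 \<le> e * \<bar>y - t\<bar>"
      using mult_right_mono[of "\<bar>y - t\<bar>" e "\<bar>y - t\<bar>"] by (simp add: power2_eq_square)
    then show "norm ((max 0 y)\<^sup>2 - (max 0 t)\<^sup>2 - 2 * max 0 t * (y - t)) \<le> e * norm (y - t)"
      using *[of y] by simp
  qed
qed

lemma linear_le_quadratic:
  fixes C N t :: real
  assumes "N > 0"
  shows "C * t \<le> C\<^sup>2 / (4 * N) + N * t\<^sup>2"
proof -
  have "0 \<le> (C - 2 * N * t)\<^sup>2 / (4 * N)" using assms by simp
  also have "(C - 2 * N * t)\<^sup>2 / (4 * N) = C\<^sup>2 / (4 * N) + N * t\<^sup>2 - C * t"
    using assms by (simp add: power2_eq_square field_simps)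
  finally show ?thesis by simp
qed

lemma le_one_plus_of_square_le:
  fixes t w :: real
  assumes "t\<^sup>2 \<le> w" shows "t \<le> w + 1"
proof -
  have "t \<le> 1 + t\<^sup>2" using linear_le_quadratic[of 1 1 t] by simp
  then show ?thesis using assms by linarith
qed

text \<open>Blow up at \<open>x0\<close> by the factor \<open>1 / s\<close> and split \<open>Y = \<tau> v + \<zeta> g0 + z\<close> with \<open>\<tau> = a \<bullet> Y\<close> and
  \<open>\<zeta> = b \<bullet> Y\<close>. The test function is linear with slopes \<open>q - e\<close> along \<open>v\<close> and \<open>c\<close> along \<open>g0\<close>, plus
  penalties on \<open>z\<close>, on \<open>\<tau> > 1\<close> and on \<open>\<zeta> < - \<kappa>\<close>. The penalties can only raise the slope along \<open>v\<close>
  and lower the one along \<open>g0\<close>, and the last one is inactive near \<open>F\<close>. The degenerate alternatives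
  \<open>a = 0\<close> and \<open>b = 0\<close> cover stationary points of the curve and interior points.\<close>

lemma oblique_test_point:
  fixes u :: "'a::euclidean_space \<Rightarrow> real" and x0 v g0 a b :: 'a
  assumes S: "compact S" and x0: "x0 \<in> S" and lip: "L-lipschitz_on S u"
    and av: "a \<bullet> v = 1 \<or> a = 0 \<and> v = 0 \<and> q \<le> 0"
    and bg: "b \<bullet> g0 = 1 \<or> b = 0 \<and> g0 = 0 \<and> c = 0"
    and ag: "a \<bullet> g0 = 0" and bv: "b \<bullet> v = 0"
    and flat: "\<And>\<kappa>. \<kappa> > 0 \<Longrightarrow> \<exists>r>0. \<forall>y\<in>S. norm (y - x0) < r \<longrightarrow> b \<bullet> (y - x0) \<le> \<kappa> * norm (y - x0)"
    and flatF: "\<And>\<kappa>. \<kappa> > 0 \<Longrightarrow> \<exists>r>0. \<forall>y\<in>F. norm (y - x0) < r \<longrightarrow> - \<kappa> * norm (y - x0) \<le> b \<bullet> (y - x0)"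
    and curve: "\<And>e. e > 0 \<Longrightarrow> \<exists>s>0. s < e \<and> (\<exists>y\<in>S. norm (y - x0 - s *\<^sub>R v) \<le> e * s \<and> u y - u x0 \<ge> (q - e) * s)"
    and e: "e > 0"
  obtains K where "\<And>d. d > 0 \<Longrightarrow> \<exists>y\<in>S. \<exists>p\<in>superdiff S u y. norm (y - x0) < d \<and> norm p \<le> K \<and>
      q - e \<le> p \<bullet> v \<and> p \<bullet> g0 \<le> c \<and> (y \<in> F \<longrightarrow> p \<bullet> g0 = c)"
proof -
  have L0: "L \<ge> 0" using lip by (rule lipschitz_on_nonneg)
  have lipD: "u y - u x \<le> L * norm (y - x)" if "x \<in> S" "y \<in> S" for x y
    using lipschitz_onD[OF lip that(2,1)] by (simp add: dist_norm dist_real_def)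
  have contu: "continuous_on S u" using lip by (rule lipschitz_on_continuous_on)
  \<comment> \<open>\<open>C\<close> dominates the linear coefficients of
    \<open>L * norm Y - \<Phi> Y\<close> in \<open>norm (z Y)\<close>,
    \<open>\<bar>a \<bullet> Y\<bar>\<close> and \<open>\<bar>b \<bullet> Y\<bar>\<close>.\<close>
  define C where "C = L + L * norm v + L * norm g0 + \<bar>c\<bar> + \<bar>q - e\<bar> + 1"
  have Lv: "L * norm v \<ge> 0" "L * norm g0 \<ge> 0" using L0 by auto
  have C: "C > 0" "L \<le> C" "L * norm v + \<bar>q - e\<bar> \<le> C" "L * norm g0 + \<bar>c\<bar> \<le> C"
    using L0 Lv unfolding C_def by linarith+
  \<comment> \<open>Tuned so that \<open>C * \<kappa> = e / 8\<close> and
    \<open>C\<^sup>2 / (2 * N) \<le> e / 4\<close>: on the face \<open>a \<bullet> Y = 0\<close> the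
    value is at most their sum, below the \<open>e / 2\<close> attained near the curve.\<close>
  define \<kappa> where "\<kappa> = e / (8 * C)"
  have \<kappa>: "\<kappa> > 0" "C * \<kappa> = e / 8" using e C by (auto simp: \<kappa>_def)
  define N where "N = 2 * C\<^sup>2 / e + 1"
  have "2 * C\<^sup>2 / e \<ge> 0" using e by simp
  then have N: "N > 0" unfolding N_def by linarith
  have CN: "C\<^sup>2 / (2 * N) \<le> e / 4"
  proof -
    have "2 * C\<^sup>2 \<le> N * e" using e by (simp add: N_def field_simps)
    then show ?thesis using N by (simp add: field_simps)
  qed
  \<comment> \<open>\<open>W\<close> is what remains after half of each quadratic penalty absorbs
    its linear term; it yields the bound \<open>M0\<close> for the penalised quantities and
    \<open>M1\<close> for \<open>norm Y\<close>. The extra \<open>1 + norm v\<close> in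
    \<open>M\<close> leaves room around the maximiser and admits the point near the curve.\<close>
  define W where "W = C * (1 + \<kappa>) + 3 * (C\<^sup>2 / (2 * N))"
  define M0 where "M0 = 2 * W / N + 1"
  define M1 where "M1 = M0 + (1 + M0) * norm v + (\<kappa> + M0) * norm g0"
  define M where "M = M1 + 1 + norm v"
  have W: "W \<ge> 0" unfolding W_def using C \<kappa> N by (intro add_nonneg_nonneg mult_nonneg_nonneg) auto
  have M0: "M0 \<ge> 0" using W N by (simp add: M0_def)
  then have M1: "M1 \<ge> 0" unfolding M1_def using \<kappa> by (intro add_nonneg_nonneg mult_nonneg_nonneg) auto
  then have M: "M > 0" unfolding M_def using norm_ge_zero[of v] by linarith

  define z where "z Y = Y - (a \<bullet> Y) *\<^sub>R v - (b \<bullet> Y) *\<^sub>R g0" for Y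
  define \<alpha> where "\<alpha> Y = max 0 (- (b \<bullet> Y + \<kappa>))" for Y
  define \<beta> where "\<beta> Y = max 0 (a \<bullet> Y - 1)" for Y
  define \<Phi> where "\<Phi> Y = (q - e) * (a \<bullet> Y) + c * (b \<bullet> Y) + N * (z Y \<bullet> z Y + (\<alpha> Y)\<^sup>2 + (\<beta> Y)\<^sup>2)" for Y
  \<comment> \<open>The gradient of \<open>\<Phi>\<close>. The linear map \<open>z\<close> sends
    \<open>v\<close> and \<open>g0\<close> to \<open>0\<close>, so its transpose makes the
    transverse penalty orthogonal to both; only \<open>\<alpha>\<close> and \<open>\<beta>\<close>
    alter the slopes along them.\<close>
  define G where "G Y = (q - e) *\<^sub>R a + c *\<^sub>R b +
     (2 * N) *\<^sub>R (z Y - (z Y \<bullet> v) *\<^sub>R a - (z Y \<bullet> g0) *\<^sub>R b - \<alpha> Y *\<^sub>R b + \<beta> Y *\<^sub>R a)" for Y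
  have d\<alpha>: "((\<lambda>Y. (\<alpha> Y)\<^sup>2) has_derivative (\<lambda>h. - (2 * \<alpha> Y * (b \<bullet> h)))) (at Y)" for Y
  proof -
    have "((\<lambda>Y. - (b \<bullet> Y + \<kappa>)) has_derivative (\<lambda>h. - (b \<bullet> h))) (at Y)"
      by (auto intro!: derivative_eq_intros)
    from has_derivative_compose[OF this has_real_derivative_pos_part_square[unfolded has_field_derivative_def]]
    show ?thesis unfolding \<alpha>_def by simp
  qed
  have d\<beta>: "((\<lambda>Y. (\<beta> Y)\<^sup>2) has_derivative (\<lambda>h. 2 * \<beta> Y * (a \<bullet> h))) (at Y)" for Y
  proof -
    have "((\<lambda>Y. a \<bullet> Y - 1) has_derivative (\<lambda>h. a \<bullet> h)) (at Y)"
      by (auto intro!: derivative_eq_intros)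
    from has_derivative_compose[OF this has_real_derivative_pos_part_square[unfolded has_field_derivative_def]]
    show ?thesis unfolding \<beta>_def by simp
  qed
  have dz: "(z has_derivative z) (at Y)" for Y
    unfolding z_def
    by (intro has_derivative_diff has_derivative_scaleR_left has_derivative_inner_right has_derivative_ident)
  have d\<Phi>: "(\<Phi> has_derivative (\<lambda>h. G Y \<bullet> h)) (at Y)" for Y
  proof -
    have "(\<Phi> has_derivative (\<lambda>h. (q - e) * (a \<bullet> h) + c * (b \<bullet> h) +
        N * ((z Y \<bullet> z h + z h \<bullet> z Y) + - (2 * \<alpha> Y * (b \<bullet> h)) + 2 * \<beta> Y * (a \<bullet> h)))) (at Y)"
      unfolding \<Phi>_def[abs_def]
      by (intro has_derivative_add has_derivative_mult_right has_derivative_inner d\<alpha> d\<beta> dz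
          has_derivative_inner_right has_derivative_ident)
    moreover have "(q - e) * (a \<bullet> h) + c * (b \<bullet> h) +
        N * ((z Y \<bullet> z h + z h \<bullet> z Y) + - (2 * \<alpha> Y * (b \<bullet> h)) + 2 * \<beta> Y * (a \<bullet> h)) = G Y \<bullet> h" for h
      unfolding G_def z_def[of h]
      by (simp add: inner_add_left inner_diff_left inner_diff_right algebra_simps inner_commute)
    ultimately show ?thesis by simp
  qed
  have cont\<Phi>: "continuous_on UNIV \<Phi>"
    using d\<Phi> by (auto simp: continuous_on_eq_continuous_at intro: has_derivative_continuous)
  \<comment> \<open>\<open>M\<close> does not depend on the blow-up scale, hence neither does
    \<open>K\<close>: the gradient bound is fixed before the contact point is brought close to
    \<open>x0\<close>.\<close>
  have "continuous_on (cball 0 M) G"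
    unfolding G_def z_def \<alpha>_def \<beta>_def by (intro continuous_intros)
  from compact_imp_bounded[OF compact_continuous_image[OF this compact_cball]]
  obtain K where "\<forall>Y\<in>cball 0 M. norm (G Y) \<le> K"
    unfolding bounded_iff by auto
  then have K: "norm (G Y) \<le> K" if "norm Y \<le> M" for Y using that by simp
  have \<Phi>0: "\<Phi> 0 = 0" using \<kappa> by (simp add: \<Phi>_def z_def \<alpha>_def \<beta>_def)
  have Gv: "q - e \<le> G Y \<bullet> v" for Y
  proof (cases "a \<bullet> v = 1")
    case True
    then have "G Y \<bullet> v = q - e + 2 * N * \<beta> Y"
      using bv by (simp add: G_def inner_add_left inner_diff_left algebra_simps)
    then show ?thesis using N by (simp add: \<beta>_def)
  next
    case False
    then show ?thesis using av e by auto
  qed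
  have Gg: "G Y \<bullet> g0 = c - 2 * N * \<alpha> Y" if "b \<noteq> 0" for Y
    using bg ag that by (simp add: G_def inner_add_left inner_diff_left algebra_simps)
  have \<alpha>0: "\<alpha> Y \<ge> 0" and \<beta>0: "\<beta> Y \<ge> 0" for Y by (auto simp: \<alpha>_def \<beta>_def)
  have est: "L * norm Y - \<Phi> Y \<le> C * (norm (z Y) + \<bar>a \<bullet> Y\<bar> + \<bar>b \<bullet> Y\<bar>) - N * ((norm (z Y))\<^sup>2 + (\<alpha> Y)\<^sup>2 + (\<beta> Y)\<^sup>2)" for Y
  proof -
    have "Y = z Y + (a \<bullet> Y) *\<^sub>R v + (b \<bullet> Y) *\<^sub>R g0" by (simp add: z_def)
    then have "norm Y \<le> norm (z Y) + \<bar>a \<bullet> Y\<bar> * norm v + \<bar>b \<bullet> Y\<bar> * norm g0"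
      by (smt (verit) norm_scaleR norm_triangle_ineq)
    then have "L * norm Y \<le> L * (norm (z Y) + \<bar>a \<bullet> Y\<bar> * norm v + \<bar>b \<bullet> Y\<bar> * norm g0)"
      using L0 by (rule mult_left_mono)
    moreover have "- ((q - e) * (a \<bullet> Y)) \<le> \<bar>q - e\<bar> * \<bar>a \<bullet> Y\<bar>" "- (c * (b \<bullet> Y)) \<le> \<bar>c\<bar> * \<bar>b \<bullet> Y\<bar>"
      using abs_ge_minus_self[of "(q - e) * (a \<bullet> Y)"] abs_ge_minus_self[of "c * (b \<bullet> Y)"]
      by (simp_all add: abs_mult)
    moreover have "L * norm (z Y) \<le> C * norm (z Y)"
      "(L * norm v + \<bar>q - e\<bar>) * \<bar>a \<bullet> Y\<bar> \<le> C * \<bar>a \<bullet> Y\<bar>" "(L * norm g0 + \<bar>c\<bar>) * \<bar>b \<bullet> Y\<bar> \<le> C * \<bar>b \<bullet> Y\<bar>"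
      using C by (intro mult_right_mono; simp)+
    ultimately show ?thesis
      unfolding \<Phi>_def power2_norm_eq_inner by (simp add: algebra_simps)
  qed
  have small: "norm (z Y) \<le> M0" "\<alpha> Y \<le> M0" "\<beta> Y \<le> M0" "norm Y \<le> M1"
    if Y: "a \<bullet> Y \<ge> 0" "b \<bullet> Y \<le> \<kappa>" "0 \<le> L * norm Y - \<Phi> Y" for Y
  proof -
    have ab: "\<bar>a \<bullet> Y\<bar> \<le> 1 + \<beta> Y" "\<bar>b \<bullet> Y\<bar> \<le> \<kappa> + \<alpha> Y" using Y \<kappa> by (auto simp: \<alpha>_def \<beta>_def)
    have "C * (norm (z Y) + \<bar>a \<bullet> Y\<bar> + \<bar>b \<bullet> Y\<bar>) \<le> C * (norm (z Y) + (1 + \<beta> Y) + (\<kappa> + \<alpha> Y))"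
      using C ab by (intro mult_left_mono add_mono) auto
    with est[of Y] Y(3) have "N * ((norm (z Y))\<^sup>2 + (\<alpha> Y)\<^sup>2 + (\<beta> Y)\<^sup>2)
        \<le> C * (1 + \<kappa>) + C * norm (z Y) + C * \<beta> Y + C * \<alpha> Y"
      by (simp add: algebra_simps)
    moreover have "C * t \<le> C\<^sup>2 / (2 * N) + N / 2 * t\<^sup>2" for t
      using linear_le_quadratic[of "N / 2" C t] N by simp
    note this[of "norm (z Y)"] this[of "\<alpha> Y"] this[of "\<beta> Y"]
    ultimately have "N / 2 * ((norm (z Y))\<^sup>2 + (\<alpha> Y)\<^sup>2 + (\<beta> Y)\<^sup>2) \<le> W"
      by (simp add: W_def algebra_simps)
    then have "(norm (z Y))\<^sup>2 + (\<alpha> Y)\<^sup>2 + (\<beta> Y)\<^sup>2 \<le> 2 * W / N" using N by (simp add: field_simps)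
    then have "(norm (z Y))\<^sup>2 \<le> 2 * W / N" "(\<alpha> Y)\<^sup>2 \<le> 2 * W / N" "(\<beta> Y)\<^sup>2 \<le> 2 * W / N"
      using zero_le_power2[of "norm (z Y)"] zero_le_power2[of "\<alpha> Y"] zero_le_power2[of "\<beta> Y"] by linarith+
    then show *: "norm (z Y) \<le> M0" "\<alpha> Y \<le> M0" "\<beta> Y \<le> M0"
      unfolding M0_def by (auto intro: le_one_plus_of_square_le)
    have "Y = z Y + (a \<bullet> Y) *\<^sub>R v + (b \<bullet> Y) *\<^sub>R g0" by (simp add: z_def)
    then have "norm Y \<le> norm (z Y) + \<bar>a \<bullet> Y\<bar> * norm v + \<bar>b \<bullet> Y\<bar> * norm g0"
      by (smt (verit) norm_scaleR norm_triangle_ineq)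
    also have "\<dots> \<le> M1"
      unfolding M1_def using * ab by (intro add_mono mult_right_mono) auto
    finally show "norm Y \<le> M1" .
  qed
  have inner0: "L * norm Y - \<Phi> Y < e / 2" if Y: "a \<bullet> Y = 0" "b \<bullet> Y \<le> \<kappa>" for Y
  proof -
    have ab: "\<bar>b \<bullet> Y\<bar> \<le> \<kappa> + \<alpha> Y" "\<beta> Y = 0" using Y \<kappa> by (auto simp: \<alpha>_def \<beta>_def)
    have "C * (norm (z Y) + \<bar>a \<bullet> Y\<bar> + \<bar>b \<bullet> Y\<bar>) \<le> C * (norm (z Y) + 0 + (\<kappa> + \<alpha> Y))"
      using C ab Y by (intro mult_left_mono add_mono) auto
    with est[of Y] ab(2) have "L * norm Y - \<Phi> Y \<le> C * \<kappa> + C * norm (z Y) + C * \<alpha> Y - N * (norm (z Y))\<^sup>2 - N * (\<alpha> Y)\<^sup>2"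
      by (simp add: algebra_simps)
    also have "\<dots> \<le> C * \<kappa> + C\<^sup>2 / (2 * N)"
      using linear_le_quadratic[OF N, of C "norm (z Y)"] linear_le_quadratic[OF N, of C "\<alpha> Y"] by simp
    also have "\<dots> < e / 2" using \<kappa>(2) CN e by linarith
    finally show ?thesis .
  qed

  show thesis
  proof (rule that)
    fix d :: real assume d: "d > 0"
    \<comment> \<open>With \<open>\<kappa> / M\<close> the flatness error on the ball of radius
      \<open>M * s\<close> is \<open>\<kappa>\<close> after rescaling by \<open>s\<close>.\<close>
    have kM: "\<kappa> / M > 0" using \<kappa> M by simp
    obtain r1 where r1: "r1 > 0" "\<And>y. y \<in> S \<Longrightarrow> norm (y - x0) < r1 \<Longrightarrow> b \<bullet> (y - x0) \<le> \<kappa> / M * norm (y - x0)"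
      using flat[OF kM] by blast
    obtain r2 where r2: "r2 > 0" "\<And>y. y \<in> F \<Longrightarrow> norm (y - x0) < r2 \<Longrightarrow> - (\<kappa> / M) * norm (y - x0) \<le> b \<bullet> (y - x0)"
      using flatF[OF kM] by blast
    define e0 where "e0 = min d (min r1 r2) / M"
    have e0: "e0 > 0" using d r1 r2 M by (simp add: e0_def)
    \<comment> \<open>A competitor for the maximum. If \<open>a \<bullet> v = 1\<close>, a point
      from \<open>curve\<close> will do: \<open>u\<close> gains nearly \<open>q\<close> per unit of
      \<open>s\<close>, while \<open>\<Phi>\<close> costs about \<open>q - e\<close>. Otherwise
      \<open>x0\<close> itself gives the value \<open>0\<close>.\<close>
    have "\<exists>s>0. s < e0 \<and> (\<exists>w\<in>S. a \<bullet> (w - x0) \<ge> 0 \<and> norm (w - x0) \<le> M * s \<and>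
        u w - s * \<Phi> ((w - x0) /\<^sub>R s) - u x0 \<ge> (if a \<bullet> v = 1 then s * (e / 2) else 0))"
    proof (cases "a \<bullet> v = 1")
      case True
      have "\<Phi> v = q - e" using True bv \<kappa> by (simp add: \<Phi>_def z_def \<alpha>_def \<beta>_def)
      with cont\<Phi> e obtain \<delta> where \<delta>: "\<delta> > 0" "\<And>Y. dist Y v < \<delta> \<Longrightarrow> dist (\<Phi> Y) (q - e) < e / 4"
        unfolding continuous_on_iff by (metis UNIV_I zero_less_divide_iff zero_less_numeral)
      \<comment> \<open>The last entry gives \<open>norm a * e1 \<le> 1\<close>, which puts the
        competitor in the half-space \<open>a \<bullet> Y \<ge> 0\<close>, and also
        \<open>e1 \<le> 1\<close>.\<close>
      define e1 where "e1 = min (min e0 (e / 4)) (min (\<delta> / 2) (1 / (norm a + 1)))"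
      have na: "norm a + 1 > 0" by (simp add: add_nonneg_pos)
      have e1: "e1 > 0" "e1 \<le> e0" "e1 \<le> e / 4" "e1 < \<delta>" "e1 \<le> 1 / (norm a + 1)"
        using e0 e \<delta> na by (auto simp: e1_def)
      have ae1: "norm a * e1 \<le> 1"
      proof -
        have "(norm a + 1) * e1 \<le> 1" using e1(5) na by (simp add: field_simps)
        then show ?thesis using e1(1) by (simp add: algebra_simps)
      qed
      have e11: "e1 \<le> 1"
      proof -
        have "1 / (norm a + 1) \<le> 1" using na by (simp add: field_simps)
        then show ?thesis using e1(5) by linarith
      qed
      obtain s w where s: "s > 0" "s < e1" and w: "w \<in> S" "norm (w - x0 - s *\<^sub>R v) \<le> e1 * s" "u w - u x0 \<ge> (q - e1) * s"
        using curve[OF e1(1)] by blast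
      define Y where "Y = (w - x0) /\<^sub>R s"
      have sY: "w - x0 = s *\<^sub>R Y" using s by (simp add: Y_def)
      have "s * norm (Y - v) \<le> e1 * s"
        using w(2) s unfolding sY by (simp add: scaleR_diff_right[symmetric])
      then have Yv: "norm (Y - v) \<le> e1" using s by (simp add: mult.commute)
      have "norm a * norm (Y - v) \<le> 1" using mult_left_mono[OF Yv, of "norm a"] ae1 by simp
      then have "\<bar>a \<bullet> (Y - v)\<bar> \<le> 1" using Cauchy_Schwarz_ineq2[of a "Y - v"] by linarith
      then have aY: "a \<bullet> Y \<ge> 0" using True by (simp add: inner_diff_right)
      have "norm Y \<le> norm v + 1" using Yv e11 norm_triangle_ineq2[of Y v] by linarith
      then have nY: "norm Y \<le> M" using M1 by (simp add: M_def)
      have "\<Phi> Y \<le> q - e + e / 4" 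
        using \<delta>(2)[of Y] Yv e1(4) unfolding dist_norm real_norm_def by linarith
      then have "s * \<Phi> Y \<le> s * (q - e + e / 4)" using s by simp
      moreover have "(q - e1) * s \<ge> (q - e / 4) * s" using e1 s by simp
      ultimately have "u w - s * \<Phi> Y - u x0 \<ge> s * (e / 2)"
        using w(3) by (simp add: algebra_simps)
      then show ?thesis using True s e1 w(1) aY nY
        by (intro exI[of _ s] conjI bexI[of _ w]) (auto simp: Y_def[symmetric] sY mult.commute)
    next
      case False
      then show ?thesis using x0 e0 M \<Phi>0
        by (intro exI[of _ "e0 / 2"] conjI bexI[of _ x0]) auto
    qed
    then obtain s w where s: "s > 0" "s < e0" and w: "w \<in> S" "a \<bullet> (w - x0) \<ge> 0" "norm (w - x0) \<le> M * s"
      and wmax: "u w - s * \<Phi> ((w - x0) /\<^sub>R s) - u x0 \<ge> (if a \<bullet> v = 1 then s * (e / 2) else 0)"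
      by blast
    have Ms: "M * s < d" "M * s < r1" "M * s < r2"
    proof -
      have "M * s < M * e0" using s M by simp
      also have "\<dots> = min d (min r1 r2)" using M by (simp add: e0_def)
      finally show "M * s < d" "M * s < r1" "M * s < r2" by auto
    qed
    \<comment> \<open>\<open>\<Phi>\<close> carries no penalty for negative
      \<open>a \<bullet> Y\<close>, so the maximum is sought in a half-space; for
      \<open>a = 0\<close> the constraint is vacuous.\<close>
    define A where "A = S \<inter> ({y. 0 \<le> a \<bullet> (y - x0)} \<inter> {y. norm (y - x0) \<le> M * s})"
    have "compact A" unfolding A_def
      by (intro compact_Int_closed[OF S] closed_Int closed_Collect_le continuous_intros)
    moreover have "w \<in> A" using w by (simp add: A_def)
    moreover have "continuous_on A (\<lambda>y. u y - s * \<Phi> ((y - x0) /\<^sub>R s))"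
      by (intro continuous_intros continuous_on_subset[OF contu] continuous_on_compose2[OF cont\<Phi>])
        (auto simp: A_def)
    ultimately obtain y where yA: "y \<in> A"
      and ymax: "\<And>w. w \<in> A \<Longrightarrow> u w - s * \<Phi> ((w - x0) /\<^sub>R s) \<le> u y - s * \<Phi> ((y - x0) /\<^sub>R s)"
      using continuous_attains_sup[of A "\<lambda>y. u y - s * \<Phi> ((y - x0) /\<^sub>R s)"] by blast
    define Y where "Y = (y - x0) /\<^sub>R s"
    have sY: "y - x0 = s *\<^sub>R Y" using s by (simp add: Y_def)
    have yS: "y \<in> S" and yM: "norm (y - x0) \<le> M * s" and ya: "a \<bullet> (y - x0) \<ge> 0" using yA by (auto simp: A_def)
    have YM: "norm Y \<le> M" using yM s unfolding sY by (simp add: mult.commute)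
    have aY: "a \<bullet> Y \<ge> 0" using ya s unfolding sY by (simp add: zero_le_mult_iff)
    have small_ratio: "\<kappa> / M * norm (y - x0) \<le> \<kappa> * s"
    proof -
      have "\<kappa> / M * norm (y - x0) \<le> \<kappa> / M * (M * s)" using kM yM by (intro mult_left_mono) auto
      then show ?thesis using M by simp
    qed
    have bY: "b \<bullet> Y \<le> \<kappa>"
    proof -
      have "b \<bullet> (y - x0) \<le> \<kappa> * s" using r1(2)[OF yS] yM Ms small_ratio by linarith
      then show ?thesis using s unfolding sY by (simp add: mult.commute)
    qed
    have val: "(if a \<bullet> v = 1 then e / 2 else 0) \<le> L * norm Y - \<Phi> Y"
    proof -
      have "(if a \<bullet> v = 1 then s * (e / 2) else 0) \<le> u y - s * \<Phi> Y - u x0"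
        using wmax ymax[OF \<open>w \<in> A\<close>] by (simp add: Y_def)
      also have "\<dots> \<le> s * (L * norm Y - \<Phi> Y)"
        using lipD[OF x0 yS] s unfolding sY by (simp add: algebra_simps)
      finally show ?thesis using s by (auto split: if_splits simp: zero_le_mult_iff)
    qed
    then have val0: "0 \<le> L * norm Y - \<Phi> Y" using e by (auto split: if_splits)
    have YM1: "norm Y \<le> M1" using small(4)[OF aY bY val0] .
    \<comment> \<open>The maximiser is off the face: by \<open>inner0\<close> values there are below
      \<open>e / 2\<close>, against \<open>val\<close>. It is therefore a local maximum relative to
      \<open>S\<close> alone.\<close>
    have "\<exists>r>0. \<forall>w. norm (w - y) < r \<longrightarrow> a \<bullet> (w - x0) \<ge> 0"
    proof (cases "a \<bullet> v = 1")
      case True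
      then have "a \<bullet> Y \<noteq> 0" using val inner0[of Y] bY by auto
      then have "a \<bullet> (y - x0) > 0" using aY s unfolding sY by simp
      then have "open {w. 0 < a \<bullet> (w - x0)}" "y \<in> {w. 0 < a \<bullet> (w - x0)}"
        by (auto intro!: open_Collect_less continuous_intros)
      then obtain r where "r > 0" "ball y r \<subseteq> {w. 0 < a \<bullet> (w - x0)}" by (meson openE)
      then show ?thesis by (intro exI[of _ r]) (force simp: dist_norm norm_minus_commute subset_iff)
    next
      case False
      then have "a = 0" using av by auto
      then show ?thesis by (intro exI[of _ 1]) auto
    qed
    then obtain r where r: "r > 0" "\<And>w. norm (w - y) < r \<Longrightarrow> a \<bullet> (w - x0) \<ge> 0" by blast
    have "((\<lambda>w. s * \<Phi> ((w - x0) /\<^sub>R s)) has_derivative (\<lambda>h. G Y \<bullet> h)) (at y)"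
    proof -
      have "((\<lambda>w. (w - x0) /\<^sub>R s) has_derivative (\<lambda>h. h /\<^sub>R s)) (at y)"
        by (auto intro!: derivative_eq_intros)
      from has_derivative_mult_right[OF has_derivative_compose[OF this d\<Phi>], of s]
      show ?thesis using s by (simp add: Y_def mult.assoc[symmetric])
    qed
    moreover have "u w - s * \<Phi> ((w - x0) /\<^sub>R s) \<le> u y - s * \<Phi> ((y - x0) /\<^sub>R s)"
      if "w \<in> S" "norm (w - y) < min r s" for w
    proof (rule ymax)
      have "norm (w - x0) \<le> norm (w - y) + norm (y - x0)" using norm_triangle_ineq[of "w - y" "y - x0"] by simp
      also have "\<dots> \<le> s + s * M1" using that YM1 s unfolding sY by (intro add_mono) auto
      also have "\<dots> \<le> M * s" using s by (simp add: M_def algebra_simps)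
      finally show "w \<in> A" using that r by (simp add: A_def)
    qed
    ultimately have sup: "G Y \<in> superdiff S u y"
      using superdiffI_touching[of "\<lambda>w. s * \<Phi> ((w - x0) /\<^sub>R s)" "G Y" y "min r s" S u] r(1) s(1) by auto
    have "G Y \<bullet> g0 \<le> c"
      using bg Gg[of Y] N \<alpha>0[of Y] by (cases "b = 0") auto
    moreover have "G Y \<bullet> g0 = c" if "y \<in> F"
    proof (cases "b = 0")
      case False
      have "- \<kappa> * s \<le> b \<bullet> (y - x0)" using r2(2)[OF that] yM Ms small_ratio by simp
      then have "s * (- \<kappa>) \<le> s * (b \<bullet> Y)" unfolding sY inner_scaleR_right by (simp only: mult.commute)
      then have "- \<kappa> \<le> b \<bullet> Y" using s(1) mult_le_cancel_left_pos by blast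
      then have "\<alpha> Y = 0" by (simp add: \<alpha>_def)
      then show ?thesis using Gg False by simp
    qed (use bg in auto)
    ultimately show "\<exists>y\<in>S. \<exists>p\<in>superdiff S u y. norm (y - x0) < d \<and> norm p \<le> K \<and>
      q - e \<le> p \<bullet> v \<and> p \<bullet> g0 \<le> c \<and> (y \<in> F \<longrightarrow> p \<bullet> g0 = c)"
      using yS sup yM Ms(1) K[OF YM] Gv[of Y] by (intro bexI[of _ y] bexI[of _ "G Y"]) auto
  qed
qed

text \<open>The slope along \<open>\<gamma> x0\<close> is prescribed as \<open>g x0 + e\<close>
  rather than \<open>g x0\<close>: at a boundary contact the oblique inequality then fails strictly,
  even after \<open>\<gamma>\<close> and \<open>g\<close> are moved to the contact point. The excess
  disappears in the limit.\<close>

lemma admissible_gradient_one_sided: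
  fixes u \<rho> g :: "'a::euclidean_space \<Rightarrow> real" and \<gamma> D\<rho> :: "'a \<Rightarrow> 'a"
  assumes bd: "bounded \<Omega>" and op: "open \<Omega>"
    and contH: "continuous_on (closure \<Omega> \<times> UNIV) (\<lambda>(x, p). H x p)"
    and contg: "continuous_on (frontier \<Omega>) g" and cont\<gamma>: "continuous_on (frontier \<Omega>) \<gamma>"
    and der: "\<And>x. (\<rho> has_derivative (\<lambda>h. D\<rho> x \<bullet> h)) (at x)"
    and dom: "\<Omega> = {x. \<rho> x < 0}"
    and obl: "\<And>x. x \<in> frontier \<Omega> \<Longrightarrow> D\<rho> x \<bullet> \<gamma> x > 0"
    and sub: "visc_subsol \<Omega> H \<gamma> g u"
    and R: "\<And>x p. x \<in> closure \<Omega> \<Longrightarrow> H x p \<le> 0 \<Longrightarrow> norm p \<le> R"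
    and lip: "L-lipschitz_on (closure \<Omega>) u"
    and x0: "x0 \<in> closure \<Omega>"
    and tang: "x0 \<in> frontier \<Omega> \<Longrightarrow> D\<rho> x0 \<bullet> v = 0"
    and curve: "\<And>e. e > 0 \<Longrightarrow> \<exists>s>0. s < e \<and> (\<exists>y\<in>closure \<Omega>. norm (y - x0 - s *\<^sub>R v) \<le> e * s \<and> u y - u x0 \<ge> (q - e) * s)"
  shows "\<exists>p. H x0 p \<le> 0 \<and> (x0 \<in> frontier \<Omega> \<longrightarrow> \<gamma> x0 \<bullet> p \<le> g x0) \<and> q \<le> p \<bullet> v"
proof -
  have S: "compact (closure \<Omega>)" using bd by simp
  have L0: "L \<ge> 0" using lip by (rule lipschitz_on_nonneg)
  have fr: "frontier \<Omega> = closure \<Omega> - \<Omega>" using op by (simp add: frontier_def interior_open)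
  note \<rho>0 = nonpos_on_closure[OF der dom]
  have \<rho>fr: "\<rho> x = 0" if "x \<in> frontier \<Omega>" for x
  proof -
    have "x \<in> closure \<Omega>" "x \<notin> \<Omega>" using that by (auto simp: fr)
    moreover have "\<not> \<rho> x < 0" using \<open>x \<notin> \<Omega>\<close> dom by blast
    ultimately show ?thesis using \<rho>0[of x] by linarith
  qed
  have q0: "q \<le> 0" if "v = 0"
  proof (rule field_le_epsilon)
    fix e :: real assume e: "e > 0"
    define e' where "e' = e / (L + 1)"
    have "(L + 1) * e' = e" using L0 by (simp add: e'_def)
    then have "L * e' + e' = e" by (simp add: distrib_right)
    moreover have "e' > 0" using e L0 by (simp add: e'_def)
    ultimately have e': "e' > 0" "L * e' + e' = e" by auto
    obtain s y where s: "s > 0" "y \<in> closure \<Omega>" "norm (y - x0) \<le> e' * s" "u y - u x0 \<ge> (q - e') * s"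
      using curve[OF e'(1)] \<open>v = 0\<close> by auto
    have "(q - e') * s \<le> L * norm (y - x0)"
      using lipschitz_onD[OF lip s(2) x0] s(4) by (simp add: dist_norm dist_real_def)
    also have "\<dots> \<le> L * (e' * s)" using s(3) L0 by (intro mult_left_mono)
    finally have "(q - e') * s \<le> (L * e') * s" by simp
    then have "q - e' \<le> L * e'" using s(1) by simp
    then show "q \<le> 0 + e" using e' by linarith
  qed
  have step: "\<exists>y\<in>closure \<Omega>. \<exists>p. norm (y - x0) < e \<and> H y p \<le> 0 \<and> q - e \<le> p \<bullet> v \<and>
      (x0 \<in> frontier \<Omega> \<longrightarrow> \<gamma> x0 \<bullet> p \<le> g x0 + e)" if e: "e > 0" for e
  proof (cases "x0 \<in> frontier \<Omega>")
    case True
    define n where "n = D\<rho> x0"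
    define b where "b = n /\<^sub>R (n \<bullet> \<gamma> x0)"
    have ng: "n \<bullet> \<gamma> x0 > 0" using obl[OF True] by (simp add: n_def)
    \<comment> \<open>\<open>a\<close> and \<open>b\<close> are dual to \<open>v\<close> and
      \<open>\<gamma> x0\<close>: the subtracted multiple of \<open>b\<close> kills the pairing with
      \<open>\<gamma> x0\<close>, and tangency, \<open>b \<bullet> v = 0\<close>, keeps the pairing
      with \<open>v\<close> equal to \<open>1\<close>. For \<open>v = 0\<close> the convention on
      division by zero gives \<open>a = 0\<close>.\<close>
    define a where "a = (v - (v \<bullet> \<gamma> x0) *\<^sub>R b) /\<^sub>R (v \<bullet> v)"
    have bg: "b \<bullet> \<gamma> x0 = 1" using ng by (simp add: b_def)
    have bv: "b \<bullet> v = 0" using tang[OF True] by (simp add: b_def n_def)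
    have ag: "a \<bullet> \<gamma> x0 = 0" using bg by (simp add: a_def inner_diff_left)
    have av: "a \<bullet> v = 1 \<or> a = 0 \<and> v = 0 \<and> q \<le> 0"
    proof (cases "v = 0")
      case True
      then show ?thesis using q0 by (simp add: a_def)
    next
      case False
      then show ?thesis using bv by (simp add: a_def inner_diff_left)
    qed
    have approx: "\<exists>r>0. \<forall>y. norm (y - x0) < r \<longrightarrow> \<bar>\<rho> y - n \<bullet> (y - x0)\<bar> \<le> \<kappa> * (n \<bullet> \<gamma> x0) * norm (y - x0)"
      if "\<kappa> > 0" for \<kappa>
    proof -
      have "\<kappa> * (n \<bullet> \<gamma> x0) > 0" using that ng by simp
      with der[of x0, unfolded has_derivative_at_alt] \<rho>fr[OF True]
      show ?thesis by (simp add: n_def)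
    qed
    have scale: "b \<bullet> h \<le> \<kappa> * t \<longleftrightarrow> n \<bullet> h \<le> \<kappa> * (n \<bullet> \<gamma> x0) * t" "- \<kappa> * t \<le> b \<bullet> h \<longleftrightarrow> - (\<kappa> * (n \<bullet> \<gamma> x0) * t) \<le> n \<bullet> h" for h \<kappa> t
      using ng by (auto simp: b_def field_simps)
    \<comment> \<open>\<open>\<rho> \<le> 0\<close> on the closure bounds the linearisation from
      above, up to the differentiability error; \<open>\<rho> = 0\<close> on the boundary bounds it
      from below as well.\<close>
    have flat: "\<exists>r>0. \<forall>y\<in>closure \<Omega>. norm (y - x0) < r \<longrightarrow> b \<bullet> (y - x0) \<le> \<kappa> * norm (y - x0)" if \<kappa>: "\<kappa> > 0" for \<kappa>
    proof -
      obtain r where r: "r > 0" "\<And>y. norm (y - x0) < r \<Longrightarrow> \<bar>\<rho> y - n \<bullet> (y - x0)\<bar> \<le> \<kappa> * (n \<bullet> \<gamma> x0) * norm (y - x0)"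
        using approx[OF \<kappa>] by blast
      show ?thesis unfolding scale
      proof (intro exI[of _ r] conjI ballI impI r(1))
        fix y assume y: "y \<in> closure \<Omega>" "norm (y - x0) < r"
        from r(2)[OF y(2)] \<rho>0[OF y(1)] show "n \<bullet> (y - x0) \<le> \<kappa> * (n \<bullet> \<gamma> x0) * norm (y - x0)" by linarith
      qed
    qed
    have flatF: "\<exists>r>0. \<forall>y\<in>frontier \<Omega>. norm (y - x0) < r \<longrightarrow> - \<kappa> * norm (y - x0) \<le> b \<bullet> (y - x0)" if \<kappa>: "\<kappa> > 0" for \<kappa>
    proof -
      obtain r where r: "r > 0" "\<And>y. norm (y - x0) < r \<Longrightarrow> \<bar>\<rho> y - n \<bullet> (y - x0)\<bar> \<le> \<kappa> * (n \<bullet> \<gamma> x0) * norm (y - x0)"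
        using approx[OF \<kappa>] by blast
      show ?thesis unfolding scale
      proof (intro exI[of _ r] conjI ballI impI r(1))
        fix y assume y: "y \<in> frontier \<Omega>" "norm (y - x0) < r"
        from r(2)[OF y(2)] \<rho>fr[OF y(1)] show "- (\<kappa> * (n \<bullet> \<gamma> x0) * norm (y - x0)) \<le> n \<bullet> (y - x0)" by linarith
      qed
    qed
    obtain K where K: "\<And>d. d > 0 \<Longrightarrow> \<exists>y\<in>closure \<Omega>. \<exists>p\<in>superdiff (closure \<Omega>) u y. norm (y - x0) < d \<and> norm p \<le> K \<and>
      q - e \<le> p \<bullet> v \<and> p \<bullet> \<gamma> x0 \<le> g x0 + e \<and> (y \<in> frontier \<Omega> \<longrightarrow> p \<bullet> \<gamma> x0 = g x0 + e)"
      using oblique_test_point[OF S x0 lip av disjI1[OF bg] ag bv flat flatF curve e, of "g x0 + e"] by metis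
    define K' where "K' = \<bar>K\<bar> + 1"
    have K': "K' > 0" "K \<le> K'" by (auto simp: K'_def)
    have "e / (2 * K') > 0" using e K' by simp
    then obtain d1 where d1: "d1 > 0" "\<And>y. y \<in> frontier \<Omega> \<Longrightarrow> dist y x0 < d1 \<Longrightarrow> dist (\<gamma> y) (\<gamma> x0) < e / (2 * K')"
      using cont\<gamma> True unfolding continuous_on_iff by meson
    have "e / 2 > 0" using e by simp
    then obtain d2 where d2: "d2 > 0" "\<And>y. y \<in> frontier \<Omega> \<Longrightarrow> dist y x0 < d2 \<Longrightarrow> dist (g y) (g x0) < e / 2"
      using contg True unfolding continuous_on_iff by meson
    have "min e (min d1 d2) > 0" using e d1 d2 by simp
    from K[OF this] obtain y p where y: "y \<in> closure \<Omega>" "p \<in> superdiff (closure \<Omega>) u y"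
      "norm (y - x0) < min e (min d1 d2)" "norm p \<le> K" "q - e \<le> p \<bullet> v" "p \<bullet> \<gamma> x0 \<le> g x0 + e"
      "y \<in> frontier \<Omega> \<longrightarrow> p \<bullet> \<gamma> x0 = g x0 + e" by blast
    have "H y p \<le> 0"
    proof (cases "y \<in> \<Omega>")
      case True
      then show ?thesis using sub y unfolding visc_subsol_def by blast
    next
      case False
      then have yF: "y \<in> frontier \<Omega>" using y by (simp add: fr)
      have dg: "norm (\<gamma> y - \<gamma> x0) < e / (2 * K')" "\<bar>g y - g x0\<bar> < e / 2"
        using d1(2)[OF yF] d2(2)[OF yF] y(3) by (auto simp: dist_norm)
      have "\<bar>(\<gamma> y - \<gamma> x0) \<bullet> p\<bar> \<le> norm (\<gamma> y - \<gamma> x0) * norm p" by (rule Cauchy_Schwarz_ineq2)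
      also have "\<dots> \<le> e / (2 * K') * K'"
        using dg(1) y(4) K' e by (intro mult_mono) auto
      also have "\<dots> = e / 2" using K' by simp
      finally have "\<bar>\<gamma> y \<bullet> p - \<gamma> x0 \<bullet> p\<bar> \<le> e / 2" by (simp add: inner_diff_left)
      moreover have "\<gamma> x0 \<bullet> p = g x0 + e" using y(7) yF by (simp add: inner_commute)
      ultimately have "\<gamma> y \<bullet> p - g y > 0" using dg(2) by linarith
      moreover have "min (H y p) (\<gamma> y \<bullet> p - g y) \<le> 0" using sub y(2) yF unfolding visc_subsol_def by blast
      ultimately show ?thesis by linarith
    qed
    then show ?thesis using y by (intro bexI[of _ y] exI[of _ p]) (auto simp: inner_commute)
  next
    case False
    then have "x0 \<in> \<Omega>" using x0 by (simp add: fr)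
    then obtain r where r: "r > 0" "ball x0 r \<subseteq> \<Omega>" using op open_contains_ball by blast
    define a where "a = v /\<^sub>R (v \<bullet> v)"
    have av: "a \<bullet> v = 1 \<or> a = 0 \<and> v = 0 \<and> q \<le> 0" using q0 by (cases "v = 0") (simp_all add: a_def)
    have b0: "(0::'a) \<bullet> 0 = 1 \<or> (0::'a) = 0 \<and> (0::'a) = 0 \<and> (0::real) = 0" by simp
    have flat: "\<exists>r>0. \<forall>y\<in>closure \<Omega>. norm (y - x0) < r \<longrightarrow> 0 \<bullet> (y - x0) \<le> \<kappa> * norm (y - x0)" if "\<kappa> > 0" for \<kappa>
      using that by (intro exI[of _ 1]) auto
    have flatF: "\<exists>r>0. \<forall>y\<in>{}. norm (y - x0) < r \<longrightarrow> - \<kappa> * norm (y - x0) \<le> 0 \<bullet> (y - x0)" if "\<kappa> > 0" for \<kappa> :: real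
      by (intro exI[of _ 1]) auto
    obtain K where "\<And>d. d > 0 \<Longrightarrow> \<exists>y\<in>closure \<Omega>. \<exists>p\<in>superdiff (closure \<Omega>) u y. norm (y - x0) < d \<and> norm p \<le> K \<and>
      q - e \<le> p \<bullet> v \<and> p \<bullet> 0 \<le> 0 \<and> (y \<in> {} \<longrightarrow> p \<bullet> 0 = 0)"
      using oblique_test_point[OF S x0 lip av b0 _ _ flat flatF curve e] by (metis inner_zero_left inner_zero_right)
    from this[of "min e r"] r(1) e obtain y p where y: "y \<in> closure \<Omega>" "p \<in> superdiff (closure \<Omega>) u y"
      "norm (y - x0) < min e r" "q - e \<le> p \<bullet> v" by auto
    then have "y \<in> \<Omega>" using r by (auto simp: dist_norm norm_minus_commute)
    then have "H y p \<le> 0" using sub y unfolding visc_subsol_def by blast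
    then show ?thesis using y False by (intro bexI[of _ y] exI[of _ p]) auto
  qed
  have "\<forall>k::nat. \<exists>y p. y \<in> closure \<Omega> \<and> norm (y - x0) < inverse (real (Suc k)) \<and> H y p \<le> 0 \<and> q - inverse (real (Suc k)) \<le> p \<bullet> v \<and>
      (x0 \<in> frontier \<Omega> \<longrightarrow> \<gamma> x0 \<bullet> p \<le> g x0 + inverse (real (Suc k)))"
    using step by (meson inverse_positive_iff_positive of_nat_0_less_iff zero_less_Suc)
  then obtain y p where yp: "\<And>k::nat. y k \<in> closure \<Omega>" "\<And>k. norm (y k - x0) < inverse (real (Suc k))" "\<And>k. H (y k) (p k) \<le> 0"
    "\<And>k. q - inverse (real (Suc k)) \<le> p k \<bullet> v" "\<And>k. x0 \<in> frontier \<Omega> \<Longrightarrow> \<gamma> x0 \<bullet> p k \<le> g x0 + inverse (real (Suc k))"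
    by metis
  have "\<forall>k. p k \<in> cball 0 R" using R[OF yp(1,3)] by simp
  then obtain p0 \<sigma> where \<sigma>: "strict_mono \<sigma>" "(p \<circ> \<sigma>) \<longlonglongrightarrow> p0"
    using seq_compactE[OF compact_imp_seq_compact[OF compact_cball[of 0 R]], of p] by blast
  have inv: "(\<lambda>k. inverse (real (Suc (\<sigma> k)))) \<longlonglongrightarrow> 0"
    using LIMSEQ_subseq_LIMSEQ[OF LIMSEQ_inverse_real_of_nat \<sigma>(1)] by (simp add: o_def)
  have plim: "(\<lambda>k. p (\<sigma> k)) \<longlonglongrightarrow> p0" using \<sigma>(2) by (simp add: o_def)
  have ylim: "(\<lambda>k. y (\<sigma> k)) \<longlonglongrightarrow> x0"
  proof (rule LIM_zero_cancel, rule tendsto_norm_zero_cancel, rule tendsto_sandwich[OF _ _ tendsto_const inv])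
    show "\<forall>\<^sub>F k in sequentially. norm (y (\<sigma> k) - x0) \<le> inverse (real (Suc (\<sigma> k)))"
      using yp(2) by (auto intro!: always_eventually less_imp_le)
  qed simp
  have "(\<lambda>k. H (y (\<sigma> k)) (p (\<sigma> k))) \<longlonglongrightarrow> H x0 p0"
    using continuous_on_tendsto_compose[OF contH tendsto_Pair[OF ylim plim]] x0 yp(1) by auto
  then have "H x0 p0 \<le> 0" by (rule tendsto_upperbound) (auto simp: yp)
  moreover have "q \<le> p0 \<bullet> v"
  proof (rule tendsto_le[OF _ tendsto_inner[OF plim tendsto_const]])
    show "(\<lambda>k. q - inverse (real (Suc (\<sigma> k)))) \<longlonglongrightarrow> q" using tendsto_diff[OF tendsto_const inv, of q] by simp
  qed (use yp(4) in auto)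
  moreover have "\<gamma> x0 \<bullet> p0 \<le> g x0" if "x0 \<in> frontier \<Omega>"
  proof (rule tendsto_le[OF _ _ tendsto_inner[OF tendsto_const plim]])
    show "(\<lambda>k. g x0 + inverse (real (Suc (\<sigma> k)))) \<longlonglongrightarrow> g x0" using tendsto_add[OF tendsto_const inv, of "g x0"] by simp
  qed (use yp(5) that in auto)
  ultimately show ?thesis by blast
qed

section \<open>Measurable selection\<close>

text \<open>The existential ranges over an uncountable ball. Relaxing \<open>\<le> 0\<close> to
  \<open>< inverse (real (Suc n))\<close> makes the condition open, so a countable dense set of
  \<open>p\<close> decides it, and compactness of the ball recovers the original.\<close>

lemma sets_exists_sublevel_cball:
  fixes \<Psi> :: "'b \<Rightarrow> 'a::euclidean_space \<Rightarrow> real"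
  assumes meas: "\<And>p. (\<lambda>t. \<Psi> t p) \<in> borel_measurable M"
    and cont: "\<And>t. t \<in> space M \<Longrightarrow> continuous_on UNIV (\<Psi> t)"
  shows "{t\<in>space M. \<exists>p\<in>cball a r. \<Psi> t p \<le> 0} \<in> sets M"
proof -
  obtain D where D: "countable D" "D \<subseteq> cball a r" "cball a r \<subseteq> closure D"
    using separable[of "cball a r"] by blast
  have eq: "(\<exists>p\<in>cball a r. \<Psi> t p \<le> 0) \<longleftrightarrow> (\<forall>n::nat. \<exists>p\<in>D. \<Psi> t p < inverse (real (Suc n)))"
    if t: "t \<in> space M" for t
  proof
    assume "\<exists>p\<in>cball a r. \<Psi> t p \<le> 0"
    then obtain p where p: "p \<in> cball a r" "\<Psi> t p \<le> 0" by blast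
    show "\<forall>n::nat. \<exists>p\<in>D. \<Psi> t p < inverse (real (Suc n))"
    proof
      fix n :: nat
      have "open {p. \<Psi> t p < inverse (real (Suc n))}"
        using cont[OF t] by (intro open_Collect_less) auto
      moreover have "\<Psi> t p < inverse (real (Suc n))" using p(2) by (rule le_less_trans) simp
      ultimately have "{p. \<Psi> t p < inverse (real (Suc n))} \<inter> D \<noteq> {}"
        using open_Int_closure_eq_empty[of "{p. \<Psi> t p < inverse (real (Suc n))}" D] p(1) D(3) by blast
      then show "\<exists>p\<in>D. \<Psi> t p < inverse (real (Suc n))" by blast
    qed
  next
    assume "\<forall>n::nat. \<exists>p\<in>D. \<Psi> t p < inverse (real (Suc n))"
    then obtain p where p: "\<And>n::nat. p n \<in> D" "\<And>n. \<Psi> t (p n) < inverse (real (Suc n))" by metis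
    then obtain p0 \<sigma> where \<sigma>: "p0 \<in> cball a r" "strict_mono \<sigma>" "(p \<circ> \<sigma>) \<longlonglongrightarrow> p0"
      using seq_compactE[OF compact_imp_seq_compact[OF compact_cball[of a r]], of p] D(2) by blast
    have "(\<lambda>n. \<Psi> t (p (\<sigma> n))) \<longlonglongrightarrow> \<Psi> t p0"
      using continuous_on_tendsto_compose[OF cont[OF t] \<sigma>(3)] by (simp add: o_def)
    moreover have "(\<lambda>n. inverse (real (Suc (\<sigma> n)))) \<longlonglongrightarrow> 0"
      using LIMSEQ_subseq_LIMSEQ[OF LIMSEQ_inverse_real_of_nat \<sigma>(2)] by (simp add: o_def)
    ultimately have "\<Psi> t p0 \<le> 0"
      by (rule LIMSEQ_le) (use p(2) less_imp_le in blast)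
    with \<sigma>(1) show "\<exists>p\<in>cball a r. \<Psi> t p \<le> 0" by blast
  qed
  have "{t\<in>space M. \<exists>p\<in>cball a r. \<Psi> t p \<le> 0} = {t\<in>space M. \<forall>n::nat. \<exists>p\<in>D. \<Psi> t p < inverse (real (Suc n))}"
    using eq by blast
  also have "\<dots> \<in> sets M"
    using D(1) meas by measurable
  finally show ?thesis .
qed

text \<open>The element of least norm is unique, so its distance to any point can be tested with
  countably many values of the defining function.\<close>

lemma measurable_selection_convex_sublevel:
  fixes \<Phi> :: "'b \<Rightarrow> 'a::euclidean_space \<Rightarrow> real"
  assumes meas: "\<And>p. (\<lambda>t. \<Phi> t p) \<in> borel_measurable M"
    and cont: "\<And>t. t \<in> space M \<Longrightarrow> continuous_on UNIV (\<Phi> t)"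
    and conv: "\<And>t. t \<in> space M \<Longrightarrow> convex {p. \<Phi> t p \<le> 0}"
    and ne: "\<And>t. t \<in> space M \<Longrightarrow> \<exists>p. \<Phi> t p \<le> 0"
  obtains f where "f \<in> borel_measurable M" "\<And>t. t \<in> space M \<Longrightarrow> \<Phi> t (f t) \<le> 0"
proof -
  define A where "A t = {p. \<Phi> t p \<le> 0}" for t
  define f where "f t = closest_point (A t) 0" for t
  have cl: "closed (A t)" if "t \<in> space M" for t
    unfolding A_def using cont[OF that] by (intro closed_Collect_le) auto
  have fA: "f t \<in> A t" if "t \<in> space M" for t
    unfolding f_def using cl[OF that] ne[OF that] by (intro closest_point_in_set) (auto simp: A_def)
  have fmin: "norm (f t) \<le> norm p" if "t \<in> space M" "p \<in> A t" for t p
    using closest_point_le[OF cl[OF that(1)] that(2), of 0] by (simp add: f_def)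
  have funiq: "p = f t" if "t \<in> space M" "p \<in> A t" "norm p \<le> norm (f t)" for t p
    unfolding f_def
  proof (rule closest_point_unique)
    show "convex (A t)" using conv[OF that(1)] by (simp add: A_def)
    show "\<forall>z\<in>A t. dist 0 p \<le> dist 0 z" 
      using order_trans[OF that(3) fmin[OF that(1)]] by simp
  qed (use cl[OF that(1)] that(2) in \<open>simp_all\<close>)
  \<comment> \<open>Settled first, because \<open>norm (f t)\<close> enters the defining function
    used for the distances.\<close>
  have normf: "(\<lambda>t. norm (f t)) \<in> borel_measurable M"
    unfolding borel_measurable_iff_le
  proof
    fix r
    have "{t\<in>space M. norm (f t) \<le> r} = {t\<in>space M. \<exists>p\<in>cball 0 r. \<Phi> t p \<le> 0}"
    proof (rule Collect_cong, rule conj_cong[OF refl])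
      fix t assume t: "t \<in> space M"
      show "norm (f t) \<le> r \<longleftrightarrow> (\<exists>p\<in>cball 0 r. \<Phi> t p \<le> 0)"
      proof
        assume "norm (f t) \<le> r"
        then show "\<exists>p\<in>cball 0 r. \<Phi> t p \<le> 0" using fA[OF t] by (intro bexI[of _ "f t"]) (auto simp: A_def)
      next
        assume "\<exists>p\<in>cball 0 r. \<Phi> t p \<le> 0"
        then obtain p where "norm p \<le> r" "p \<in> A t" by (auto simp: A_def)
        then show "norm (f t) \<le> r" using fmin[OF t, of p] by linarith
      qed
    qed
    then show "{t\<in>space M. norm (f t) \<le> r} \<in> sets M"
      using sets_exists_sublevel_cball[OF meas cont] by simp
  qed
  have distf: "(\<lambda>t. dist a (f t)) \<in> borel_measurable M" for a
    unfolding borel_measurable_iff_le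
  proof
    fix r
    \<comment> \<open>The sublevel set of this maximum is the single point \<open>f t\<close>, so
      the ball meets it exactly when it contains \<open>f t\<close>.\<close>
    have "{t\<in>space M. dist a (f t) \<le> r} =
        {t\<in>space M. \<exists>p\<in>cball a r. max (\<Phi> t p) (norm p - norm (f t)) \<le> 0}"
    proof (rule Collect_cong, rule conj_cong[OF refl])
      fix t assume t: "t \<in> space M"
      have "max (\<Phi> t p) (norm p - norm (f t)) \<le> 0 \<longleftrightarrow> p = f t" for p
      proof
        assume "max (\<Phi> t p) (norm p - norm (f t)) \<le> 0"
        then have "p \<in> A t" "norm p \<le> norm (f t)" by (simp_all add: A_def)
        then show "p = f t" by (rule funiq[OF t])
      next
        assume "p = f t"
        then show "max (\<Phi> t p) (norm p - norm (f t)) \<le> 0" using fA[OF t] by (simp add: A_def)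
      qed
      then have "(\<exists>p\<in>cball a r. max (\<Phi> t p) (norm p - norm (f t)) \<le> 0) \<longleftrightarrow> (\<exists>p\<in>cball a r. p = f t)"
        by (simp only:)
      then show "dist a (f t) \<le> r \<longleftrightarrow> (\<exists>p\<in>cball a r. max (\<Phi> t p) (norm p - norm (f t)) \<le> 0)"
        by (simp only: mem_cball bex_simps) auto
    qed
    also have "\<dots> \<in> sets M"
    proof (rule sets_exists_sublevel_cball)
      show "(\<lambda>t. max (\<Phi> t p) (norm p - norm (f t))) \<in> borel_measurable M" for p
        by (intro borel_measurable_max borel_measurable_diff meas normf borel_measurable_const)
      show "continuous_on UNIV (\<lambda>p. max (\<Phi> t p) (norm p - norm (f t)))" if "t \<in> space M" for t
        by (intro continuous_on_max cont[OF that] continuous_intros)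
    qed
    finally show "{t\<in>space M. dist a (f t) \<le> r} \<in> sets M" .
  qed
  have "f \<in> borel_measurable M"
  proof (rule borel_measurable_euclidean_space[THEN iffD2], rule ballI)
    fix i :: 'a assume i: "i \<in> Basis"
    \<comment> \<open>Polarisation with \<open>norm i = 1\<close> recovers the coordinates from
      distances.\<close>
    have "f t \<bullet> i = ((norm (f t))\<^sup>2 + 1 - (dist i (f t))\<^sup>2) / 2" for t
      using i by (simp add: dist_norm power2_norm_eq_inner inner_diff_left inner_diff_right inner_commute)
    moreover have "(\<lambda>t. ((norm (f t))\<^sup>2 + 1 - (dist i (f t))\<^sup>2) / 2) \<in> borel_measurable M"
      using normf distf[of i] by measurable
    ultimately show "(\<lambda>t. f t \<bullet> i) \<in> borel_measurable M" by presburger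
  qed
  then show thesis using that fA by (auto simp: A_def)
qed

section \<open>Gradients along curves\<close>

text \<open>The sign \<open>\<sigma>\<close> treats the curve and its reversal together: running
  backwards negates both \<open>v\<close> and \<open>q\<close>.\<close>

lemma curve_points_near:
  fixes \<eta> :: "real \<Rightarrow> 'a::euclidean_space" and w :: "'a \<Rightarrow> real"
  assumes d\<eta>: "(\<eta> has_vector_derivative v) (at t)"
    and dw: "((\<lambda>s. w (\<eta> s)) has_real_derivative q) (at t)"
    and t: "t \<in> {a<..<b}" and \<eta>S: "\<forall>t\<in>{a..b}. \<eta> t \<in> S"
    and \<sigma>: "\<bar>\<sigma>\<bar> = 1" and e: "e > 0"
  shows "\<exists>s>0. s < e \<and> (\<exists>y\<in>S. norm (y - \<eta> t - s *\<^sub>R (\<sigma> *\<^sub>R v)) \<le> e * s \<and> w y - w (\<eta> t) \<ge> (\<sigma> * q - e) * s)"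
proof -
  obtain d1 where d1: "d1 > 0" "\<And>y. norm (y - t) < d1 \<Longrightarrow> norm (\<eta> y - \<eta> t - (y - t) *\<^sub>R v) \<le> e * norm (y - t)"
    using d\<eta> e unfolding has_vector_derivative_def has_derivative_at_alt by blast
  obtain d2 where d2: "d2 > 0" "\<And>y. norm (y - t) < d2 \<Longrightarrow> norm (w (\<eta> y) - w (\<eta> t) - q * (y - t)) \<le> e * norm (y - t)"
    using dw e unfolding has_field_derivative_def has_derivative_at_alt by blast
  define s where "s = min (min e (min d1 d2)) (min (t - a) (b - t)) / 2"
  have s: "s > 0" "s < e" "s < d1" "s < d2" "s < t - a" "s < b - t"
    using e d1 d2 t by (auto simp: s_def)
  define y where "y = t + \<sigma> * s"
  have yt: "y - t = \<sigma> * s" "norm (y - t) = s" using \<sigma> s by (auto simp: y_def abs_mult)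
  have "\<bar>y - t\<bar> = s" using yt by simp
  then have "y \<in> {a..b}" using s by auto
  moreover have "norm (\<eta> y - \<eta> t - s *\<^sub>R (\<sigma> *\<^sub>R v)) \<le> e * s"
    using d1(2)[of y] s(3) unfolding yt(2) by (simp add: yt(1) mult.commute)
  moreover have "w (\<eta> y) - w (\<eta> t) \<ge> (\<sigma> * q - e) * s"
  proof -
    have "\<bar>w (\<eta> y) - w (\<eta> t) - q * (\<sigma> * s)\<bar> \<le> e * s"
      using d2(2)[of y] s(4) unfolding yt(2) by (simp add: yt(1))
    then show ?thesis by (simp add: algebra_simps abs_le_iff)
  qed
  ultimately show ?thesis using s \<eta>S by (intro exI[of _ s] conjI bexI[of _ "\<eta> y"]) auto
qed

lemma admissible_gradient_along_curve:
  fixes u \<rho> g :: "'a::euclidean_space \<Rightarrow> real" and \<gamma> D\<rho> :: "'a \<Rightarrow> 'a" and \<eta> :: "real \<Rightarrow> 'a"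
  assumes bd: "bounded \<Omega>" and op: "open \<Omega>"
    and contH: "continuous_on (closure \<Omega> \<times> UNIV) (\<lambda>(x, p). H x p)"
    and convH: "\<forall>x\<in>closure \<Omega>. convex_on UNIV (H x)"
    and contg: "continuous_on (frontier \<Omega>) g" and cont\<gamma>: "continuous_on (frontier \<Omega>) \<gamma>"
    and der: "\<And>x. (\<rho> has_derivative (\<lambda>h. D\<rho> x \<bullet> h)) (at x)"
    and dom: "\<Omega> = {x. \<rho> x < 0}"
    and obl: "\<And>x. x \<in> frontier \<Omega> \<Longrightarrow> D\<rho> x \<bullet> \<gamma> x > 0"
    and sub: "visc_subsol \<Omega> H \<gamma> g u"
    and R: "\<And>x p. x \<in> closure \<Omega> \<Longrightarrow> H x p \<le> 0 \<Longrightarrow> norm p \<le> R"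
    and lip: "L-lipschitz_on (closure \<Omega>) u"
    and d\<eta>: "(\<eta> has_vector_derivative v) (at t)"
    and du: "((\<lambda>s. u (\<eta> s)) has_real_derivative q) (at t)"
    and t: "t \<in> {a<..<b}" and \<eta>S: "\<forall>t\<in>{a..b}. \<eta> t \<in> closure \<Omega>"
  shows "\<exists>p. H (\<eta> t) p \<le> 0 \<and> (\<eta> t \<in> frontier \<Omega> \<longrightarrow> \<gamma> (\<eta> t) \<bullet> p \<le> g (\<eta> t)) \<and> p \<bullet> v = q"
proof -
  have x0: "\<eta> t \<in> closure \<Omega>" using t \<eta>S by auto
  have tang: "D\<rho> (\<eta> t) \<bullet> v = 0" if fr: "\<eta> t \<in> frontier \<Omega>"
  proof -
    have "((\<lambda>s. \<rho> (\<eta> s)) has_derivative (\<lambda>s. D\<rho> (\<eta> t) \<bullet> (s *\<^sub>R v))) (at t)"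
      using has_derivative_compose[OF d\<eta>[unfolded has_vector_derivative_def] der] .
    then have "((\<lambda>s. \<rho> (\<eta> s)) has_real_derivative D\<rho> (\<eta> t) \<bullet> v) (at t)"
      by (simp add: has_field_derivative_def mult.commute[of _ "D\<rho> (\<eta> t) \<bullet> v"])
    moreover have "min (t - a) (b - t) > 0" using t by simp
    moreover have "\<forall>s. \<bar>t - s\<bar> < min (t - a) (b - t) \<longrightarrow> \<rho> (\<eta> s) \<le> \<rho> (\<eta> t)"
    proof (intro allI impI)
      fix s assume "\<bar>t - s\<bar> < min (t - a) (b - t)"
      then have "s \<in> {a..b}" by auto
      then have "\<eta> s \<in> closure \<Omega>" using \<eta>S by blast
      then have "\<rho> (\<eta> s) \<le> 0" by (rule nonpos_on_closure[OF der dom])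
      moreover have "\<eta> t \<notin> \<Omega>" using fr op by (simp add: frontier_def interior_open)
      then have "\<rho> (\<eta> t) \<ge> 0" using dom by (metis mem_Collect_eq not_less)
      ultimately show "\<rho> (\<eta> s) \<le> \<rho> (\<eta> t)" by linarith
    qed
    ultimately show ?thesis by (rule DERIV_local_max)
  qed
  have one_sided: "\<exists>p. H (\<eta> t) p \<le> 0 \<and> (\<eta> t \<in> frontier \<Omega> \<longrightarrow> \<gamma> (\<eta> t) \<bullet> p \<le> g (\<eta> t)) \<and> \<sigma> * q \<le> p \<bullet> (\<sigma> *\<^sub>R v)"
    if "\<bar>\<sigma>\<bar> = 1" for \<sigma>
    using tang
    by (intro admissible_gradient_one_sided[OF bd op contH contg cont\<gamma> der dom obl sub R lip x0]
        curve_points_near[OF d\<eta> du t \<eta>S that]) auto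
  obtain p1 where p1: "H (\<eta> t) p1 \<le> 0" "\<eta> t \<in> frontier \<Omega> \<longrightarrow> \<gamma> (\<eta> t) \<bullet> p1 \<le> g (\<eta> t)" "q \<le> p1 \<bullet> v"
    using one_sided[of 1] by auto
  obtain p2 where p2: "H (\<eta> t) p2 \<le> 0" "\<eta> t \<in> frontier \<Omega> \<longrightarrow> \<gamma> (\<eta> t) \<bullet> p2 \<le> g (\<eta> t)" "p2 \<bullet> v \<le> q"
    using one_sided[of "-1"] by auto
  obtain l where l: "0 \<le> l" "l \<le> 1" "(1 - l) * (p1 \<bullet> v) + l * (p2 \<bullet> v) = q"
  proof (cases "p1 \<bullet> v = p2 \<bullet> v")
    case True
    then show thesis using that[of 0] p1 p2 by simp
  next
    case False
    then have pos: "p1 \<bullet> v - p2 \<bullet> v > 0" using p1 p2 by simp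
    define l where "l = (p1 \<bullet> v - q) / (p1 \<bullet> v - p2 \<bullet> v)"
    have "l * (p1 \<bullet> v - p2 \<bullet> v) = p1 \<bullet> v - q" using pos by (simp add: l_def)
    then have "(1 - l) * (p1 \<bullet> v) + l * (p2 \<bullet> v) = q" by (simp add: algebra_simps)
    moreover have "0 \<le> l" "l \<le> 1" using p1(3) p2(3) pos by (simp_all add: l_def)
    ultimately show thesis using that by blast
  qed
  define p where "p = (1 - l) *\<^sub>R p1 + l *\<^sub>R p2"
  have "H (\<eta> t) p \<le> (1 - l) * H (\<eta> t) p1 + l * H (\<eta> t) p2"
    unfolding p_def using convH x0 l by (intro convex_onD) auto
  also have "\<dots> \<le> 0" using p1 p2 l by (simp add: mult_nonneg_nonpos add_nonpos_nonpos)
  finally have "H (\<eta> t) p \<le> 0" .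
  moreover have "\<gamma> (\<eta> t) \<bullet> p \<le> g (\<eta> t)" if "\<eta> t \<in> frontier \<Omega>"
    using convex_bound_le[of "\<gamma> (\<eta> t) \<bullet> p1" "g (\<eta> t)" "\<gamma> (\<eta> t) \<bullet> p2" "1 - l" l] p1 p2 l that
    by (simp add: p_def inner_add_right)
  moreover have "p \<bullet> v = q" using l by (simp add: p_def inner_add_left)
  ultimately show ?thesis by blast
qed

section \<open>Measurability of derivatives\<close>

lemma difference_quotients_tendsto:
  assumes "(f has_vector_derivative v) (at t)"
  shows "(\<lambda>n. real (Suc n) *\<^sub>R (f (t + inverse (real (Suc n))) - f t)) \<longlonglongrightarrow> v"
proof (rule LIMSEQ_I)
  fix e :: real assume e: "e > 0"
  then obtain d where d: "d > 0" "\<And>y. norm (y - t) < d \<Longrightarrow> norm (f y - f t - (y - t) *\<^sub>R v) \<le> e / 2 * norm (y - t)"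
    using assms unfolding has_vector_derivative_def has_derivative_at_alt by (meson half_gt_zero)
  obtain N where N: "inverse (real (Suc N)) < d" using reals_Archimedean[OF d(1)] by blast
  show "\<exists>N. \<forall>n\<ge>N. norm (real (Suc n) *\<^sub>R (f (t + inverse (real (Suc n))) - f t) - v) < e"
  proof (intro exI[of _ N] allI impI)
    fix n assume "N \<le> n"
    define h where "h = inverse (real (Suc n))"
    have h: "h > 0" "real (Suc n) * h = 1" by (simp_all add: h_def)
    have "h \<le> inverse (real (Suc N))" using \<open>N \<le> n\<close> by (simp add: h_def field_simps)
    then have "norm (f (t + h) - f t - h *\<^sub>R v) \<le> e / 2 * h" using d(2)[of "t + h"] N h by simp
    then have "real (Suc n) * norm (f (t + h) - f t - h *\<^sub>R v) \<le> real (Suc n) * (e / 2 * h)"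
      by (intro mult_left_mono) auto
    also have "\<dots> = e / 2" using h(2) by (metis mult.assoc mult.commute mult_1)
    also have "real (Suc n) * norm (f (t + h) - f t - h *\<^sub>R v) = norm (real (Suc n) *\<^sub>R (f (t + h) - f t - h *\<^sub>R v))"
      by simp
    also have "real (Suc n) *\<^sub>R (f (t + h) - f t - h *\<^sub>R v) = real (Suc n) *\<^sub>R (f (t + h) - f t) - v"
      using h(2) by (simp add: scaleR_diff_right del: of_nat_Suc)
    finally show "norm (real (Suc n) *\<^sub>R (f (t + inverse (real (Suc n))) - f t) - v) < e"
      using e unfolding h_def by linarith
  qed
qed

text \<open>Since \<open>lim\<close> is total, the limit of difference quotients is a measurable
  function on the whole interval, also at times without a derivative.\<close>

lemma measurable_derivative:
  fixes f :: "real \<Rightarrow> 'a::euclidean_space"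
  assumes cont: "continuous_on {a..b} f"
  obtains f' where "f' \<in> borel_measurable (lebesgue_on {a..b})"
    "\<And>t v. t \<in> {a<..<b} \<Longrightarrow> (f has_vector_derivative v) (at t) \<Longrightarrow> f' t = v"
proof -
  \<comment> \<open>\<open>min b\<close> keeps the shifted argument in the interval where
    \<open>f\<close> is continuous; at an interior \<open>t\<close> it is inactive for large
    \<open>n\<close>.\<close>
  define D where "D n t = real (Suc n) *\<^sub>R (f (min b (t + inverse (real (Suc n)))) - f t)" for n t
  define f' where "f' t = lim (\<lambda>n. D n t)" for t
  have "D n \<in> borel_measurable (lebesgue_on {a..b})" for n
  proof (rule continuous_imp_measurable_on_sets_lebesgue)
    have "\<And>t. t \<in> {a..b} \<Longrightarrow> min b (t + inverse (real (Suc n))) \<in> {a..b}"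
      by (auto simp: min_def intro: add_increasing2)
    then show "continuous_on {a..b} (D n)"
      unfolding D_def by (intro continuous_intros cont continuous_on_compose2[OF cont]) auto
  qed simp
  then have "f' \<in> borel_measurable (lebesgue_on {a..b})"
    unfolding f'_def by (rule borel_measurable_lim_metric)
  moreover have "f' t = v" if t: "t \<in> {a<..<b}" and d: "(f has_vector_derivative v) (at t)" for t v
  proof -
    obtain N where N: "inverse (real (Suc N)) < b - t" using reals_Archimedean[of "b - t"] t by auto
    have "D n t = real (Suc n) *\<^sub>R (f (t + inverse (real (Suc n))) - f t)" if "n \<ge> N" for n
    proof -
      have "inverse (real (Suc n)) \<le> inverse (real (Suc N))" using that by (simp add: field_simps)
      then have "t + inverse (real (Suc n)) \<le> b" using N by linarith
      then show ?thesis unfolding D_def by (simp only: min_absorb2)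
    qed
    then have "\<forall>\<^sub>F n in sequentially. real (Suc n) *\<^sub>R (f (t + inverse (real (Suc n))) - f t) = D n t"
      unfolding eventually_sequentially by metis
    from Lim_transform_eventually[OF difference_quotients_tendsto[OF d] this]
    show ?thesis unfolding f'_def by (rule limI)
  qed
  ultimately show thesis using that by blast
qed

lemma AE_lebesgue_onI:
  assumes "negligible N" "S \<in> sets lebesgue" "\<And>t. t \<in> S \<Longrightarrow> t \<notin> N \<Longrightarrow> P t"
  shows "AE t in lebesgue_on S. P t"
proof -
  have "AE t in lebesgue. t \<in> S \<longrightarrow> P t"
    using assms by (intro AE_I'[of N]) (auto simp: negligible_iff_null_sets)
  then show ?thesis using assms(2) by (subst AE_restrict_space_iff) auto
qed

theorem theorem2p1:
  fixes \<Omega> :: "'a::euclidean_space set"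
    and H :: "'a \<Rightarrow> 'a \<Rightarrow> real" and g :: "'a \<Rightarrow> real" and \<gamma> :: "'a \<Rightarrow> 'a"
    and \<rho> :: "'a \<Rightarrow> real" and D\<rho> :: "'a \<Rightarrow> 'a"
    and u :: "'a \<Rightarrow> real" and \<eta> :: "real \<Rightarrow> 'a" and T :: real
  assumes dom: "open \<Omega>" "connected \<Omega>" "bounded \<Omega>" "\<Omega> \<noteq> {}"
    and contH: "continuous_on (closure \<Omega> \<times> UNIV) (\<lambda>(x, p). H x p)"
    and contg: "continuous_on (frontier \<Omega>) g"
    and cont\<gamma>: "continuous_on (frontier \<Omega>) \<gamma>"
    and A1: "\<forall>x\<in>closure \<Omega>. convex_on UNIV (H x)"
    and A2: "\<forall>x\<in>closure \<Omega>. filterlim (H x) at_top at_infinity"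
    and A3_deriv: "\<forall>x. (\<rho> has_derivative (\<lambda>h. D\<rho> x \<bullet> h)) (at x)"
    and A3_C1: "continuous_on UNIV D\<rho>"
    and A3_dom: "\<Omega> = {x. \<rho> x < 0}"
    and A3_nondeg: "\<forall>x\<in>frontier \<Omega>. D\<rho> x \<noteq> 0"
    and A4: "\<forall>x\<in>frontier \<Omega>. (D\<rho> x /\<^sub>R norm (D\<rho> x)) \<bullet> \<gamma> x > 0"
    and crit: "critical_value_zero \<Omega> H \<gamma> g"
    and sub: "visc_subsol \<Omega> H \<gamma> g u"
    and T: "T > 0"
    and AC: "abs_continuous_on {0..T} \<eta>"
    and \<eta>_in: "\<forall>t\<in>{0..T}. \<eta> t \<in> closure \<Omega>"
  shows "\<exists>p :: real \<Rightarrow> 'a.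
           p \<in> borel_measurable (lebesgue_on {0..T}) \<and>
           (\<exists>C. AE t in lebesgue_on {0..T}. norm (p t) \<le> C) \<and>
           (AE t in lebesgue_on {0..T}. \<exists>v. (\<eta> has_vector_derivative v) (at t) \<and>
                 ((\<lambda>s. u (\<eta> s)) has_real_derivative (p t \<bullet> v)) (at t)) \<and>
           (AE t in lebesgue_on {0..T}. H (\<eta> t) (p t) \<le> 0) \<and>
           (AE t in lebesgue_on {0..T}. \<eta> t \<in> frontier \<Omega> \<longrightarrow> \<gamma> (\<eta> t) \<bullet> p t \<le> g (\<eta> t))"
proof -
  have S: "compact (closure \<Omega>)" using dom by simp
  have der: "\<And>x. (\<rho> has_derivative (\<lambda>h. D\<rho> x \<bullet> h)) (at x)" using A3_deriv by blast
  have nz: "\<And>x. x \<in> frontier \<Omega> \<Longrightarrow> D\<rho> x \<noteq> 0" using A3_nondeg by blast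
  have obl: "D\<rho> x \<bullet> \<gamma> x > 0" if "x \<in> frontier \<Omega>" for x
    using A4 nz[OF that] that by (auto simp: zero_less_mult_iff)
  obtain R where R: "R > 0" "\<And>x p. x \<in> closure \<Omega> \<Longrightarrow> H x p \<le> 0 \<Longrightarrow> norm p \<le> R"
    using uniformly_bounded_sublevels[OF S contH A1 A2] by blast
  have contu: "continuous_on (closure \<Omega>) u" using sub by (simp add: visc_subsol_def)
  have grad: "\<forall>x\<in>\<Omega>. \<forall>p\<in>superdiff (closure \<Omega>) u x. norm p \<le> R"
    using sub R(2) closure_subset[of \<Omega>] by (auto simp: visc_subsol_def)
  obtain L where lip: "L-lipschitz_on (closure \<Omega>) u"
    using lipschitz_on_closure[OF dom(3,1) contu grad R(1) der A3_C1 A3_dom nz] by blast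
  have ACu: "abs_continuous_on {0..T} (\<lambda>t. u (\<eta> t))"
    using \<eta>_in lipschitz_onD[OF lip]
    by (intro abs_continuous_on_lipschitz_image[OF AC, where S = "closure \<Omega>" and L = L])
      (auto simp: dist_norm)
  have cont\<eta>: "continuous_on {0..T} \<eta>" using AC by (rule abs_continuous_on_imp_continuous_on)
  have contu\<eta>: "continuous_on {0..T} (\<lambda>t. u (\<eta> t))" using ACu by (rule abs_continuous_on_imp_continuous_on)
  obtain v where v: "v \<in> borel_measurable (lebesgue_on {0..T})"
    "\<And>t w. t \<in> {0<..<T} \<Longrightarrow> (\<eta> has_vector_derivative w) (at t) \<Longrightarrow> v t = w"
    using measurable_derivative[OF cont\<eta>] by blast
  obtain q where q: "q \<in> borel_measurable (lebesgue_on {0..T})"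
    "\<And>t w. t \<in> {0<..<T} \<Longrightarrow> ((\<lambda>s. u (\<eta> s)) has_vector_derivative w) (at t) \<Longrightarrow> q t = w"
    using measurable_derivative[OF contu\<eta>] by blast
  \<comment> \<open>The endpoints are included because the curve is constrained only on
    \<open>{0..T}\<close>, while the argument at a time uses both sides of it.\<close>
  define N where "N = {0, T} \<union> {t\<in>{0<..<T}. \<nexists>w. (\<eta> has_vector_derivative w) (at t)}
      \<union> {t\<in>{0<..<T}. \<nexists>w. ((\<lambda>s. u (\<eta> s)) has_real_derivative w) (at t)}"
  have N: "negligible N"
    unfolding N_def
    using abs_continuous_on_differentiable_ae[OF AC] abs_continuous_on_differentiable_ae_real[OF ACu]
    by (intro negligible_Un) auto
  have good: "t \<in> {0<..<T} \<and> (\<eta> has_vector_derivative v t) (at t) \<and> ((\<lambda>s. u (\<eta> s)) has_real_derivative q t) (at t)"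
    if t: "t \<in> {0..T}" "t \<notin> N" for t
  proof -
    have t0: "t \<in> {0<..<T}" using t by (auto simp: N_def)
    then obtain w1 w2 where w: "(\<eta> has_vector_derivative w1) (at t)" "((\<lambda>s. u (\<eta> s)) has_real_derivative w2) (at t)"
      using t unfolding N_def by blast
    moreover have "v t = w1" using v(2) t0 w(1) by blast
    moreover have "q t = w2" using q(2) t0 w(2) by (simp add: has_real_derivative_iff_has_vector_derivative)
    ultimately show ?thesis using t0 by simp
  qed
  define B where "B = {t\<in>{0..T}. \<eta> t \<in> frontier \<Omega>}"
  \<comment> \<open>Zero off \<open>B\<close> imposes nothing, since the maximum in
    \<open>\<Phi>\<close> already contains an absolute value.\<close>
  define \<beta> where "\<beta> t p = (if t \<in> B then \<gamma> (\<eta> t) \<bullet> p - g (\<eta> t) else 0)" for t p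
  \<comment> \<open>One sublevel condition for all three requirements, the equation entering as an
    absolute value. On \<open>N\<close>, where no admissible \<open>p\<close> has been constructed,
    \<open>norm p\<close> leaves exactly \<open>0\<close>, so the selection hypotheses hold at every
    time.\<close>
  define \<Phi> where "\<Phi> t p = (if t \<in> N then norm p else max (H (\<eta> t) p) (max \<bar>p \<bullet> v t - q t\<bar> (\<beta> t p)))" for t p
  have Bm: "B \<in> sets lebesgue"
  proof -
    have "closed B"
      unfolding B_def using continuous_closed_preimage[OF cont\<eta> _ frontier_closed[of \<Omega>]]
      by (simp add: vimage_def Int_def conj_commute)
    then show ?thesis by simp
  qed
  have \<beta>m: "(\<lambda>t. \<beta> t p) \<in> borel_measurable (lebesgue_on {0..T})" for p
  proof -
    have "continuous_on B (\<lambda>t. \<gamma> (\<eta> t) \<bullet> p - g (\<eta> t))"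
      by (intro continuous_intros continuous_on_compose2[OF cont\<gamma>] continuous_on_compose2[OF contg]
          continuous_on_subset[OF cont\<eta>]) (auto simp: B_def)
    from continuous_imp_measurable_on_sets_lebesgue[OF this Bm]
    have "(\<lambda>t. if t \<in> B then \<gamma> (\<eta> t) \<bullet> p - g (\<eta> t) else 0) \<in> borel_measurable lebesgue"
      using borel_measurable_if[OF Bm, of "\<lambda>t. \<gamma> (\<eta> t) \<bullet> p - g (\<eta> t)"] by simp
    then show ?thesis unfolding \<beta>_def by (rule measurable_restrict_space1)
  qed
  have Hm: "(\<lambda>t. H (\<eta> t) p) \<in> borel_measurable (lebesgue_on {0..T})" for p
  proof (rule continuous_imp_measurable_on_sets_lebesgue)
    have "continuous_on {0..T} (\<lambda>t. (\<eta> t, p))" by (intro continuous_intros cont\<eta>)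
    from continuous_on_compose2[OF contH this] \<eta>_in
    show "continuous_on {0..T} (\<lambda>t. H (\<eta> t) p)" by auto
  qed simp
  have Nm: "{t \<in> space (lebesgue_on {0..T}). t \<in> N} \<in> sets (lebesgue_on {0..T})"
    using negligible_imp_sets[OF N] by (auto simp: sets_restrict_space space_restrict_space Int_def conj_commute intro!: image_eqI[of _ _ N])
  have cH: "continuous_on UNIV (H x)" if "x \<in> closure \<Omega>" for x
  proof -
    have "continuous_on UNIV (\<lambda>p. (x, p))" by (intro continuous_intros)
    from continuous_on_compose2[OF contH this] that show ?thesis by auto
  qed
  obtain p where p: "p \<in> borel_measurable (lebesgue_on {0..T})"
    "\<And>t. t \<in> space (lebesgue_on {0..T}) \<Longrightarrow> \<Phi> t (p t) \<le> 0"
  proof (rule measurable_selection_convex_sublevel)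
    fix p
    have "(\<lambda>t. max (H (\<eta> t) p) (max \<bar>p \<bullet> v t - q t\<bar> (\<beta> t p))) \<in> borel_measurable (lebesgue_on {0..T})"
      using Hm \<beta>m v(1) q(1) by measurable
    then show "(\<lambda>t. \<Phi> t p) \<in> borel_measurable (lebesgue_on {0..T})"
      unfolding \<Phi>_def using Nm by (intro measurable_If) auto
  next
    fix t assume "t \<in> space (lebesgue_on {0..T})"
    then have t: "t \<in> {0..T}" by (simp add: space_restrict_space)
    then have \<eta>t: "\<eta> t \<in> closure \<Omega>" using \<eta>_in by blast
    show "continuous_on UNIV (\<Phi> t)"
      unfolding \<Phi>_def \<beta>_def
      by (cases "t \<in> N"; cases "t \<in> B") (auto intro!: continuous_intros continuous_on_max cH[OF \<eta>t])
    show "convex {p. \<Phi> t p \<le> 0}"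
    proof (cases "t \<in> N")
      case True
      then have "{p. \<Phi> t p \<le> 0} = {0}" by (auto simp: \<Phi>_def)
      then show ?thesis by simp
    next
      case False
      then have "{p. \<Phi> t p \<le> 0} = {p. H (\<eta> t) p \<le> 0} \<inter> ({p. v t \<bullet> p = q t} \<inter> {p. t \<in> B \<longrightarrow> \<gamma> (\<eta> t) \<bullet> p \<le> g (\<eta> t)})"
        by (auto simp: \<Phi>_def \<beta>_def inner_commute)
      moreover have "convex {p. H (\<eta> t) p \<le> 0}"
      proof (rule convexI)
        fix x y :: 'a and a b :: real
        assume h: "x \<in> {p. H (\<eta> t) p \<le> 0}" "y \<in> {p. H (\<eta> t) p \<le> 0}" "0 \<le> a" "0 \<le> b" "a + b = 1"
        have "H (\<eta> t) (a *\<^sub>R x + b *\<^sub>R y) \<le> a * H (\<eta> t) x + b * H (\<eta> t) y"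
          using A1 \<eta>t h by (auto simp: convex_on_def)
        also have "\<dots> \<le> 0" using h by (simp add: mult_nonneg_nonpos add_nonpos_nonpos)
        finally show "a *\<^sub>R x + b *\<^sub>R y \<in> {p. H (\<eta> t) p \<le> 0}" by simp
      qed
      moreover have "convex {p. t \<in> B \<longrightarrow> \<gamma> (\<eta> t) \<bullet> p \<le> g (\<eta> t)}"
        by (cases "t \<in> B") (simp_all add: convex_halfspace_le)
      ultimately show ?thesis by (simp add: convex_Int convex_hyperplane)
    qed
    show "\<exists>p. \<Phi> t p \<le> 0"
    proof (cases "t \<in> N")
      case True
      then show ?thesis by (intro exI[of _ 0]) (simp add: \<Phi>_def)
    next
      case False
      note G = good[OF t False]
      have "\<exists>p. H (\<eta> t) p \<le> 0 \<and> (\<eta> t \<in> frontier \<Omega> \<longrightarrow> \<gamma> (\<eta> t) \<bullet> p \<le> g (\<eta> t)) \<and> p \<bullet> v t = q t"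
        by (rule admissible_gradient_along_curve[OF dom(3,1) contH A1 contg cont\<gamma> der A3_dom _ sub _ lip _ _ _ \<eta>_in])
          (use obl R(2) G in blast)+
      then obtain p where "H (\<eta> t) p \<le> 0" "\<eta> t \<in> frontier \<Omega> \<longrightarrow> \<gamma> (\<eta> t) \<bullet> p \<le> g (\<eta> t)" "p \<bullet> v t = q t"
        by blast
      then show ?thesis using False by (intro exI[of _ p]) (auto simp: \<Phi>_def \<beta>_def B_def)
    qed
  qed (rule that)
  have key: "H (\<eta> t) (p t) \<le> 0" "p t \<bullet> v t = q t" "\<eta> t \<in> frontier \<Omega> \<longrightarrow> \<gamma> (\<eta> t) \<bullet> p t \<le> g (\<eta> t)"
    if "t \<in> {0..T}" "t \<notin> N" for t
    using p(2)[of t] that by (auto simp: space_restrict_space \<Phi>_def \<beta>_def B_def)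
  show ?thesis
  proof (intro exI[of _ p] conjI exI[of _ R] p(1); rule AE_lebesgue_onI[OF N])
    fix t assume t: "t \<in> {0..T}" "t \<notin> N"
    \<comment> \<open>The essential bound is the coercivity constant, as \<open>p t\<close> lies in
      the zero sublevel set of \<open>H (\<eta> t)\<close>.\<close>
    then show "norm (p t) \<le> R" using R(2) key(1) \<eta>_in by blast
    show "H (\<eta> t) (p t) \<le> 0" using key t by blast
    show "\<eta> t \<in> frontier \<Omega> \<longrightarrow> \<gamma> (\<eta> t) \<bullet> p t \<le> g (\<eta> t)" using key t by blast
    show "\<exists>v. (\<eta> has_vector_derivative v) (at t) \<and> ((\<lambda>s. u (\<eta> s)) has_real_derivative (p t \<bullet> v)) (at t)"
      using good[OF t] key(2)[OF t] by auto
  qed auto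
qed

end
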